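(* For every $\beta\in(9,\infty)$ there exist initial data $u_0\in\mathcal{L}(1)$ such that the solution $u$ of the $\beta$-Szegő equation $$i\partial_t u=\Pi(|u|^2u)-\beta\,S\,\Pi\big(|S^\dagger u|^2S^\dagger u\big)$$ with $u(0)=u_0$ has polynomially growing Sobolev norms at late times: for every $s>\tfrac12$, $$\|u(t)\|_{H^s}\simeq t^{\,2s-1}\qquad\text{as }t\to\infty .$$
   Context: $L^2_+(\mathbb{S}^1)$ is the closed subspace of $L^2(\mathbb{S}^1)$ of functions $u=\sum_{n\ge 0}\alpha_ne^{in\theta}$; such $u$ is identified with $u(z)=\sum_{n\ge0}\alpha_nz^n$. $H^s_+(\mathbb{S}^1)=H^s(\mathbb{S}^1)\cap L^2_+(\mathbb{S}^1)$, with $\|u\|_{H^s}^2=\sum_{n\ge0}(1+n)^{2s}|\alpha_n|^2$. $\Pi:L^2(\mathbb{S}^1)\to L^2_+(\mathbb{S}^1)$ is the Szegő projector (removing negative Fourier modes). $S$ is the shift $Sh=e^{i\theta}h$ on $L^2_+$, and $S^\dagger$ is its adjoint, $(S^\dagger h)_n=h_{n+1}$. The equation is globally well-posed in $H^s_+(\mathbb{S}^1)$ for $s>1/2$. $\mathcal{L}(1)$ is the set of rational functions $u(z)=A(z)/B(z)$ where $A,B$ are complex polynomials of degree at most $1$ with no common factors, $\deg A=1$ or $\deg B=1$, and $B$ has no zeros in the closed unit disk. $f(t)\simeq g(t)$ as $t\to\infty$ means that there are constants $0<m\le M<\infty$ (possibly depending on $s$, $\beta$ and $u_0$) and $T$ with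 $m\,g(t)\le f(t)\le M\,g(t)$ for all $t\ge T$. *)

theory Defs
  imports "HOL-Analysis.Analysis" "HOL-Computational_Algebra.Polynomial"
begin

text \<open>
  An element \<open>u = \<Sum>n\<ge>0. \<alpha>\<^sub>n e\<^bsup>in\<theta>\<^esup>\<close> of \<open>L\<^sup>2\<^sub>+\<close> is represented by the sequence
  \<open>\<alpha>\<close> of its Fourier coefficients, so that equality of sequences is equality in \<open>L\<^sup>2\<close>;
  functions on the circle are functions of the angle \<open>\<theta>\<close>.
\<close>

type_synonym hardy = "nat \<Rightarrow> complex"

text \<open>
  The function on the circle with coefficients \<open>\<alpha>\<close>. For \<open>\<alpha>\<close> in \<open>H\<^sup>s\<^sub>+\<close>, \<open>s > 1/2\<close>, the
  series converges absolutely, by Cauchy-Schwarz.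
\<close>

definition circle_fun :: "hardy \<Rightarrow> real \<Rightarrow> complex" where
  "circle_fun \<alpha> \<theta> = (\<Sum>n. \<alpha> n * cis (real n * \<theta>))"

definition fourier_coeff :: "(real \<Rightarrow> complex) \<Rightarrow> int \<Rightarrow> complex" where
  "fourier_coeff f k =
     (LINT \<theta>:{0..2*pi}|lborel. f \<theta> * cis (- (of_int k * \<theta>))) / of_real (2 * pi)"

definition szego_projector :: "(real \<Rightarrow> complex) \<Rightarrow> hardy" where
  "szego_projector f = (\<lambda>n. fourier_coeff f (int n))"

definition shift :: "hardy \<Rightarrow> hardy" where
  "shift h = (\<lambda>n. case n of 0 \<Rightarrow> 0 | Suc m \<Rightarrow> h m)"

definition shift_adj :: "hardy \<Rightarrow> hardy" where
  "shift_adj h = (\<lambda>n. h (Suc n))"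

lemma circle_fun_shift:
  assumes "summable (\<lambda>n. h n * cis (real n * \<theta>))"
  shows "circle_fun (shift h) \<theta> = cis \<theta> * circle_fun h \<theta>"
proof -
  have e: "shift h (Suc n) * cis (real (Suc n) * \<theta>) = cis \<theta> * (h n * cis (real n * \<theta>))" for n
    by (simp add: shift_def cis_mult algebra_simps)
  have "(\<lambda>n. shift h (Suc n) * cis (real (Suc n) * \<theta>)) sums (cis \<theta> * circle_fun h \<theta>)"
    unfolding e circle_fun_def by (intro sums_mult summable_sums assms)
  then have "(\<lambda>n. shift h n * cis (real n * \<theta>)) sums (cis \<theta> * circle_fun h \<theta>)"
    by (subst (asm) sums_Suc_iff) (simp add: shift_def)
  then show ?thesis
    unfolding circle_fun_def by (rule sums_unique[symmetric])
qed

lemma shift_adjoint: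
  assumes "summable (\<lambda>n. g n * cnj (h (Suc n)))"
  shows "(\<Sum>n. shift g n * cnj (h n)) = (\<Sum>n. g n * cnj (shift_adj h n))"
proof -
  have "(\<lambda>n. shift g (Suc n) * cnj (h (Suc n))) sums (\<Sum>n. g n * cnj (shift_adj h n))"
    using assms by (simp add: shift_def shift_adj_def summable_sums)
  then have "(\<lambda>n. shift g n * cnj (h n)) sums (\<Sum>n. g n * cnj (shift_adj h n))"
    by (subst (asm) sums_Suc_iff) (simp add: shift_def)
  then show ?thesis
    by (rule sums_unique[symmetric])
qed

definition sobolev_plus :: "real \<Rightarrow> hardy set" where
  "sobolev_plus s = {\<alpha>. summable (\<lambda>n. (1 + real n) powr (2 * s) * (cmod (\<alpha> n))\<^sup>2)}"

definition sobolev_norm :: "real \<Rightarrow> hardy \<Rightarrow> real" where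
  "sobolev_norm s \<alpha> = sqrt (\<Sum>n. (1 + real n) powr (2 * s) * (cmod (\<alpha> n))\<^sup>2)"

definition cubic :: "(real \<Rightarrow> complex) \<Rightarrow> real \<Rightarrow> complex" where
  "cubic f = (\<lambda>\<theta>. of_real ((cmod (f \<theta>))\<^sup>2) * f \<theta>)"

definition beta_szego_rhs :: "real \<Rightarrow> hardy \<Rightarrow> hardy" where
  "beta_szego_rhs \<beta> \<alpha> = (\<lambda>n.
     szego_projector (cubic (circle_fun \<alpha>)) n
     - of_real \<beta> * shift (szego_projector (cubic (circle_fun (shift_adj \<alpha>)))) n)"

definition has_sobolev_derivative ::
    "real \<Rightarrow> (real \<Rightarrow> hardy) \<Rightarrow> hardy \<Rightarrow> real \<Rightarrow> bool" where
  "has_sobolev_derivative s u D t \<longleftrightarrow>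
     ((\<lambda>h. sobolev_norm s (\<lambda>n. (u (t + h) n - u t n) / of_real h - D n)) \<longlongrightarrow> 0) (at 0)"

text \<open>
  A global solution in \<open>H\<^sup>s\<^sub>+\<close> is a curve \<open>\<real> \<rightarrow> H\<^sup>s\<^sub>+\<close>, differentiable in the \<open>H\<^sup>s\<close> norm
  (hence continuous), satisfying the equation at every time. For \<open>s > 1/2\<close> the right-hand
  side is a locally Lipschitz vector field on \<open>H\<^sup>s\<^sub>+\<close>, so such a curve is automatically \<open>C\<^sup>1\<close>.
\<close>

definition beta_szego_solution ::
    "real \<Rightarrow> real \<Rightarrow> hardy \<Rightarrow> (real \<Rightarrow> hardy) \<Rightarrow> bool" where
  "beta_szego_solution \<beta> s u0 u \<longleftrightarrow>
     u 0 = u0 \<and> (\<forall>t. u t \<in> sobolev_plus s) \<and>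
     (\<forall>t. \<exists>D \<in> sobolev_plus s. has_sobolev_derivative s u D t \<and>
        (\<forall>n. \<i> * D n = beta_szego_rhs \<beta> (u t) n))"

definition unique_beta_szego_solution ::
    "real \<Rightarrow> real \<Rightarrow> hardy \<Rightarrow> (real \<Rightarrow> hardy) \<Rightarrow> bool" where
  "unique_beta_szego_solution \<beta> s u0 u \<longleftrightarrow>
     beta_szego_solution \<beta> s u0 u \<and> (\<forall>v. beta_szego_solution \<beta> s u0 v \<longrightarrow> v = u)"

text \<open>The Taylor coefficients at \<open>0\<close> of the rational functions in \<open>\<L>(1)\<close>.\<close>

definition rational_L1 :: "hardy set" where
  "rational_L1 = {\<alpha>. \<exists>A B :: complex poly.
     degree A \<le> 1 \<and> degree B \<le> 1 \<and> coprime A B \<and> (degree A = 1 \<or> degree B = 1) \<and>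
     (\<forall>z. cmod z \<le> 1 \<longrightarrow> poly B z \<noteq> 0) \<and>
     (\<forall>z. cmod z \<le> 1 \<longrightarrow> (\<lambda>n. \<alpha> n * z ^ n) sums (poly A z / poly B z))}"

definition comparable_at_top :: "(real \<Rightarrow> real) \<Rightarrow> (real \<Rightarrow> real) \<Rightarrow> bool" where
  "comparable_at_top f g \<longleftrightarrow>
     (\<exists>m M T. 0 < m \<and> m \<le> M \<and> (\<forall>t\<ge>T. m * g t \<le> f t \<and> f t \<le> M * g t))"

end

theory Submission
  imports Defs
begin

text \<open>
  The sequences \<open>b, c, cp, cp\<^sup>2, \<dots>\<close>, the Taylor coefficients of \<open>b + cz/(1 - pz)\<close>, form an invariant
  manifold on which the equation is an ODE for \<open>(b, c, p)\<close>. Its conserved quantities are the mass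
  \<open>|b|\<^sup>2 + |c|\<^sup>2/y\<close>, the momentum \<open>|c|\<^sup>2/y\<^sup>2\<close> and the energy, where \<open>y = 1 - |p|\<^sup>2\<close>. For \<open>\<beta> > 9\<close> they can be tuned
  such that \<open>y'\<^sup>2 = 4y\<^sup>3(A - By)\<close> with \<open>A > 0\<close>, whence \<open>1/y\<close> is a quadratic polynomial in \<open>t\<close> and the pole \<open>1/p\<close>
  approaches the circle at the rate \<open>y \<sim> t\<^sup>-\<^sup>2\<close>. Since \<open>|c| = y\<close>, the squared \<open>H\<^sup>s\<close> norm is of the order of
  \<open>y\<^sup>2 \<Sum>n\<^sup>2\<^sup>s(1 - y)\<^sup>n \<sim> y\<^sup>1\<^sup>-\<^sup>2\<^sup>s\<close>. Uniqueness is a Gronwall argument in \<open>L\<^sup>2\<close>: on sets bounded in \<open>H\<^sup>s\<close>, hence in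
  \<open>L\<^sup>\<infinity>\<close>, the right-hand side is Lipschitz in \<open>L\<^sup>2\<close> by Bessel's inequality and Parseval's identity.
\<close>

section \<open>Fourier coefficients on the circle\<close>

text \<open>The pole can reach the circle only on an exceptional level set. With momentum 1, the
  product \<open>Z\<close> of \<open>c\<close> with the conjugates of \<open>b\<close> and
  \<open>p\<close> satisfies \<open>|Z|^2 = (N - y) y^2 (1 - y)\<close>, \<open>N\<close> being the
  mass, and the energy makes \<open>Re Z\<close> a quadratic polynomial in \<open>y\<close>. Its
  constant term must vanish if \<open>y\<close> is to tend to 0, and then
  \<open>y'^2 = 4 (|Z|^2 - (Re Z)^2)\<close> has the factor \<open>y^2\<close>. A cofactor positive
  at \<open>y = 0\<close> would let \<open>y\<close> decay exponentially, a negative one keeps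
  \<open>y\<close> away from 0; polynomial decay is the degenerate case in which the cofactor
  vanishes at 0, and this fixes the mass. The orbit is built backwards: \<open>y\<close> is
  explicit, the moduli and \<open>Z\<close> are algebraic in \<open>y\<close> and \<open>t\<close>,
  two phases come from quadrature, and \<open>p\<close> is recovered from \<open>Z\<close>.
  Differentiation then confirms a global solution, one curve for all \<open>s\<close>. Uniqueness is
  settled in L^2 because there sup bounds control the cubic term.\<close>

abbreviation circle_integral :: "(real \<Rightarrow> 'a::{banach,second_countable_topology}) \<Rightarrow> 'a" where
  "circle_integral f \<equiv> (LINT \<theta>:{0..2*pi}|lborel. f \<theta>)"

lemma circle_integrable:
  fixes f :: "real \<Rightarrow> 'a::euclidean_space"
  assumes "continuous_on UNIV f"
  shows "set_integrable lborel {0..2*pi} f"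
  using assms continuous_on_subset by (intro borel_integrable_atLeastAtMost') blast

lemma circle_integral_const: "circle_integral (\<lambda>_. c::real) = 2 * pi * c"
  by (simp add: set_lebesgue_integral_def)

lemma circle_integral_mono:
  fixes f g :: "real \<Rightarrow> real"
  assumes "continuous_on UNIV f" "continuous_on UNIV g" "\<And>\<theta>. f \<theta> \<le> g \<theta>"
  shows "circle_integral f \<le> circle_integral g"
  using assms by (intro set_integral_mono circle_integrable) auto

lemma circle_integral_add:
  fixes f g :: "real \<Rightarrow> 'a::euclidean_space"
  assumes "continuous_on UNIV f" "continuous_on UNIV g"
  shows "circle_integral (\<lambda>\<theta>. f \<theta> + g \<theta>) = circle_integral f + circle_integral g"
  using assms by (intro set_integral_add circle_integrable)

lemma circle_integral_diff:
  fixes f g :: "real \<Rightarrow> 'a::euclidean_space"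
  assumes "continuous_on UNIV f" "continuous_on UNIV g"
  shows "circle_integral (\<lambda>\<theta>. f \<theta> - g \<theta>) = circle_integral f - circle_integral g"
  using assms by (intro set_integral_diff circle_integrable)

lemma circle_integral_of_real:
  fixes f :: "real \<Rightarrow> real"
  shows "circle_integral (\<lambda>\<theta>. complex_of_real (f \<theta>)) = of_real (circle_integral f)"
  unfolding set_lebesgue_integral_def integral_complex_of_real[symmetric]
  by (simp add: scaleR_conv_of_real)

lemma circle_integral_cnj: "circle_integral (\<lambda>\<theta>. cnj (f \<theta>)) = cnj (circle_integral f)"
proof -
  have "indicator {0..2*pi} \<theta> *\<^sub>R cnj (f \<theta>) = cnj (indicator {0..2*pi} \<theta> *\<^sub>R f \<theta>)" for \<theta> :: real
    by (simp add: scaleR_conv_of_real)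
  then show ?thesis
    unfolding set_lebesgue_integral_def by (simp only: Bochner_Integration.integral_cnj)
qed

lemma circle_integral_Re:
  assumes "continuous_on UNIV f"
  shows "circle_integral (\<lambda>\<theta>. Re (f \<theta>)) = Re (circle_integral f)"
  using circle_integrable[OF assms] unfolding set_lebesgue_integral_def set_integrable_def
  by (subst integral_Re[symmetric]) auto

lemma circle_integral_sums:
  fixes f :: "nat \<Rightarrow> real \<Rightarrow> complex"
  assumes cont: "\<And>i. continuous_on UNIV (f i)"
    and le: "\<And>i \<theta>. norm (f i \<theta>) \<le> M i" and M: "summable M"
  shows "(\<lambda>i. circle_integral (f i)) sums circle_integral (\<lambda>\<theta>. \<Sum>i. f i \<theta>)"
proof -
  let ?g = "\<lambda>i \<theta>. indicator {0..2*pi} \<theta> *\<^sub>R f i \<theta>"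
  have M0: "0 \<le> M i" for i
    using norm_ge_zero order_trans le by blast
  have int: "integrable lborel (?g i)" for i
    using circle_integrable[OF cont] unfolding set_integrable_def .
  have nsum: "summable (\<lambda>i. norm (f i \<theta>))" for \<theta>
    by (rule summable_comparison_test'[OF M, of 0]) (auto simp: le)
  have "(\<lambda>i. integral\<^sup>L lborel (?g i)) sums (LINT \<theta>|lborel. (\<Sum>i. ?g i \<theta>))"
  proof (rule sums_integral)
    show "integrable lborel (?g i)" for i by (rule int)
    show "AE \<theta> in lborel. summable (\<lambda>i. norm (?g i \<theta>))"
      using nsum by (auto simp: summable_mult)
    have eq: "norm (?g i \<theta>) = indicator {0..2*pi} \<theta> *\<^sub>R norm (f i \<theta>)" for i \<theta> by simp
    have "(LINT \<theta>|lborel. norm (?g i \<theta>)) \<le> 2 * pi * M i" for i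
    proof -
      have "(LINT \<theta>|lborel. norm (?g i \<theta>)) = circle_integral (\<lambda>\<theta>. norm (f i \<theta>))"
        unfolding set_lebesgue_integral_def eq ..
      also have "\<dots> \<le> circle_integral (\<lambda>\<theta>. M i)"
        by (intro circle_integral_mono le continuous_intros cont)
      finally show ?thesis by (simp only: circle_integral_const)
    qed
    then show "summable (\<lambda>i. LINT \<theta>|lborel. norm (?g i \<theta>))"
      by (intro summable_comparison_test'[OF summable_mult[OF M, of "2*pi"], of 0]) auto
  qed
  moreover have "(\<Sum>i. ?g i \<theta>) = indicator {0..2*pi} \<theta> *\<^sub>R (\<Sum>i. f i \<theta>)" for \<theta>
    using suminf_scaleR_right[OF summable_norm_cancel[OF nsum]] by metis
  ultimately show ?thesis
    unfolding set_lebesgue_integral_def by simp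
qed

lemma circle_integral_cis:
  "circle_integral (\<lambda>\<theta>. cis (of_int k * \<theta>)) = (if k = 0 then of_real (2 * pi) else 0)"
proof (cases "k = 0")
  case True
  then show ?thesis
    using circle_integral_of_real[of "\<lambda>_. 1"] circle_integral_const[of 1] by simp
next
  case False
  let ?F = "\<lambda>\<theta>::real. exp (\<i> * of_int k * of_real \<theta>) / (\<i> * of_int k)"
  have cis_exp: "cis (of_int k * \<theta>) = exp (\<i> * of_int k * of_real \<theta>)" for \<theta>
    by (simp add: cis_conv_exp mult.assoc)
  have "((\<lambda>z. exp (\<i> * of_int k * z) / (\<i> * of_int k)) has_field_derivative exp (\<i> * of_int k * z)) (at z)" for z
    using False by (auto intro!: derivative_eq_intros)
  then have "(?F has_vector_derivative cis (of_int k * \<theta>)) (at \<theta> within {0..2*pi})" for \<theta>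
    unfolding cis_exp by (intro has_vector_derivative_real_field) (auto intro: has_field_derivative_at_within)
  then have F: "circle_integral (\<lambda>\<theta>. cis (of_int k * \<theta>)) = ?F (2*pi) - ?F 0"
    unfolding set_lebesgue_integral_def
    by (intro integral_FTC_atLeastAtMost) (auto intro!: continuous_intros)
  have "cis (of_int k * (2*pi)) = 1"
    using cis_multiple_2pi[of "of_int k"] by (simp add: mult_ac)
  then have "?F (2*pi) - ?F 0 = 0"
    unfolding cis_exp by simp
  with F show ?thesis
    using False by (simp only: if_False)
qed

lemma continuous_suminf:
  fixes f :: "nat \<Rightarrow> real \<Rightarrow> complex"
  assumes "\<And>i. continuous_on UNIV (f i)" "\<And>i \<theta>. norm (f i \<theta>) \<le> M i" "summable M"
  shows "continuous_on UNIV (\<lambda>\<theta>. \<Sum>i. f i \<theta>)"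
proof (rule uniform_limit_theorem)
  show "uniform_limit UNIV (\<lambda>n \<theta>. \<Sum>i<n. f i \<theta>) (\<lambda>\<theta>. \<Sum>i. f i \<theta>) sequentially"
    by (rule Weierstrass_m_test) (use assms in auto)
  show "\<forall>\<^sub>F n in sequentially. continuous_on UNIV (\<lambda>\<theta>. \<Sum>i<n. f i \<theta>)"
    by (intro always_eventually allI continuous_intros assms)
qed simp

text \<open>The frequencies \<open>\<sigma>\<close> are arbitrary so that one termwise integration
  serves both expansions below: \<open>\<sigma> = int\<close> for analytic functions and
  \<open>\<sigma> k = - (k + 1)\<close> for functions with negative modes only. The value is left as
  a series because \<open>\<sigma>\<close> may take the value \<open>k\<close> several times or
  never.\<close>

lemma fourier_coeff_series:
  fixes \<sigma> :: "nat \<Rightarrow> int"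
  assumes "summable (\<lambda>i. cmod (a i))"
  shows "(\<lambda>i. if \<sigma> i = k then a i else 0) sums
      fourier_coeff (\<lambda>\<theta>. \<Sum>i. a i * cis (of_int (\<sigma> i) * \<theta>)) k"
proof -
  let ?e = "\<lambda>\<theta>. cis (- (of_int k * \<theta>))"
  let ?f = "\<lambda>i \<theta>. a i * cis (of_int (\<sigma> i) * \<theta>)"
  have 1: "(\<lambda>i. circle_integral (\<lambda>\<theta>. ?f i \<theta> * ?e \<theta>)) sums circle_integral (\<lambda>\<theta>. \<Sum>i. ?f i \<theta> * ?e \<theta>)"
  proof (rule circle_integral_sums[OF _ _ assms])
    show "continuous_on UNIV (\<lambda>\<theta>. ?f i \<theta> * ?e \<theta>)" for i
      by (intro continuous_intros)
    show "cmod (?f i \<theta> * ?e \<theta>) \<le> cmod (a i)" for i \<theta>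
      by (simp add: norm_mult)
  qed
  have 2: "(\<Sum>i. ?f i \<theta> * ?e \<theta>) = (\<Sum>i. ?f i \<theta>) * ?e \<theta>" for \<theta>
  proof -
    have "summable (\<lambda>i. cmod (?f i \<theta>))"
      using assms by (simp add: norm_mult)
    from suminf_mult2[OF summable_norm_cancel[OF this]] show ?thesis by (rule sym)
  qed
  have 3: "circle_integral (\<lambda>\<theta>. ?f i \<theta> * ?e \<theta>) = of_real (2*pi) * (if \<sigma> i = k then a i else 0)" for i
  proof -
    have "?f i \<theta> * ?e \<theta> = a i * cis (of_int (\<sigma> i - k) * \<theta>)" for \<theta>
      by (simp add: mult.assoc cis_mult left_diff_distrib)
    then have "circle_integral (\<lambda>\<theta>. ?f i \<theta> * ?e \<theta>) = a i * circle_integral (\<lambda>\<theta>. cis (of_int (\<sigma> i - k) * \<theta>))"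
      by (simp only: set_integral_mult_right)
    then show ?thesis
      unfolding circle_integral_cis by auto
  qed
  have "(\<lambda>i. of_real (2*pi) * (if \<sigma> i = k then a i else 0) / of_real (2*pi)) sums
      (circle_integral (\<lambda>\<theta>. (\<Sum>i. ?f i \<theta>) * ?e \<theta>) / of_real (2*pi))"
    using sums_divide[OF 1] unfolding 2 3 .
  then show ?thesis
    unfolding fourier_coeff_def by simp
qed

lemma fourier_coeff_add:
  assumes "continuous_on UNIV f" "continuous_on UNIV g"
  shows "fourier_coeff (\<lambda>\<theta>. f \<theta> + g \<theta>) k = fourier_coeff f k + fourier_coeff g k"
  unfolding fourier_coeff_def distrib_right
  by (subst circle_integral_add) (auto intro!: continuous_intros assms simp: add_divide_distrib)

lemma fourier_coeff_diff:
  assumes "continuous_on UNIV f" "continuous_on UNIV g"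
  shows "fourier_coeff (\<lambda>\<theta>. f \<theta> - g \<theta>) k = fourier_coeff f k - fourier_coeff g k"
  unfolding fourier_coeff_def left_diff_distrib
  by (subst circle_integral_diff) (auto intro!: continuous_intros assms simp: diff_divide_distrib)

lemma fourier_coeff_cmult: "fourier_coeff (\<lambda>\<theta>. c * f \<theta>) k = c * fourier_coeff f k"
  unfolding fourier_coeff_def by (simp add: mult.assoc)

lemma continuous_circle_fun:
  assumes "summable (\<lambda>n. cmod (\<alpha> n))"
  shows "continuous_on UNIV (circle_fun \<alpha>)"
  unfolding circle_fun_def[abs_def] using assms
  by (intro continuous_suminf[where M = "\<lambda>n. cmod (\<alpha> n)"]) (auto intro!: continuous_intros simp: norm_mult)

lemma fourier_coeff_circle_fun:
  assumes "summable (\<lambda>n. cmod (\<alpha> n))"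
  shows "fourier_coeff (circle_fun \<alpha>) (int n) = \<alpha> n"
proof -
  have "(\<lambda>i. if int i = int n then \<alpha> i else 0) sums fourier_coeff (circle_fun \<alpha>) (int n)"
    using fourier_coeff_series[OF assms, of int "int n"] by (simp add: circle_fun_def[abs_def])
  moreover have "(\<lambda>i. if int i = int n then \<alpha> i else 0) sums \<alpha> n"
    using sums_single[of n \<alpha>] by simp
  ultimately show ?thesis
    by (rule sums_unique2)
qed

text \<open>Only one factor of \<open>u * cnj u\<close> is expanded. The other stays a function,
  bounded by the sum of the \<open>cmod (\<alpha> n)\<close>, so a single exchange of sum and
  integral suffices, and each term is \<open>\<alpha> n\<close> times the conjugate of a Fourier
  coefficient of \<open>u\<close>.\<close>

lemma parseval_circle_fun:
  assumes "summable (\<lambda>n. cmod (\<alpha> n))"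
  shows "(\<lambda>n. (cmod (\<alpha> n))\<^sup>2) sums (circle_integral (\<lambda>\<theta>. (cmod (circle_fun \<alpha> \<theta>))\<^sup>2) / (2 * pi))"
proof -
  let ?u = "circle_fun \<alpha>"
  have c: "continuous_on UNIV ?u"
    by (rule continuous_circle_fun[OF assms])
  have bd: "cmod (?u \<theta>) \<le> (\<Sum>n. cmod (\<alpha> n))" for \<theta>
    unfolding circle_fun_def using assms
    by (intro order_trans[OF summable_norm]) (auto simp: norm_mult)
  let ?f = "\<lambda>n \<theta>. \<alpha> n * cis (real n * \<theta>)"
  have nsum: "summable (\<lambda>n. cmod (?f n \<theta>))" for \<theta>
    using assms by (simp add: norm_mult)
  have 1: "(\<lambda>n. circle_integral (\<lambda>\<theta>. ?f n \<theta> * cnj (?u \<theta>))) sums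
      circle_integral (\<lambda>\<theta>. \<Sum>n. ?f n \<theta> * cnj (?u \<theta>))"
  proof (rule circle_integral_sums[OF _ _ summable_mult2[OF assms]])
    show "continuous_on UNIV (\<lambda>\<theta>. ?f n \<theta> * cnj (?u \<theta>))" for n
      by (intro continuous_intros c)
    show "cmod (?f n \<theta> * cnj (?u \<theta>)) \<le> cmod (\<alpha> n) * (\<Sum>n. cmod (\<alpha> n))" for n \<theta>
      using mult_left_mono[OF bd] by (simp add: norm_mult)
  qed
  have 2: "(\<Sum>n. ?f n \<theta> * cnj (?u \<theta>)) = of_real ((cmod (?u \<theta>))\<^sup>2)" for \<theta>
  proof -
    have "(\<Sum>n. ?f n \<theta> * cnj (?u \<theta>)) = ?u \<theta> * cnj (?u \<theta>)"
      using suminf_mult2[OF summable_norm_cancel[OF nsum[of \<theta>]], of "cnj (?u \<theta>)"]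
      by (simp add: circle_fun_def)
    then show ?thesis
      by (simp only: complex_norm_square)
  qed
  have 3: "circle_integral (\<lambda>\<theta>. ?f n \<theta> * cnj (?u \<theta>)) = of_real (2 * pi * (cmod (\<alpha> n))\<^sup>2)" for n
  proof -
    have "?f n \<theta> * cnj (?u \<theta>) = \<alpha> n * cnj (?u \<theta> * cis (- (of_int (int n) * \<theta>)))" for \<theta>
      by (simp add: cis_cnj)
    then have "circle_integral (\<lambda>\<theta>. ?f n \<theta> * cnj (?u \<theta>)) =
        \<alpha> n * cnj (circle_integral (\<lambda>\<theta>. ?u \<theta> * cis (- (of_int (int n) * \<theta>))))"
      by (simp only: set_integral_mult_right circle_integral_cnj)
    also have "\<dots> = \<alpha> n * cnj (of_real (2*pi) * fourier_coeff ?u (int n))"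
      unfolding fourier_coeff_def by simp
    also have "\<dots> = of_real (2 * pi * (cmod (\<alpha> n))\<^sup>2)"
      unfolding fourier_coeff_circle_fun[OF assms] of_real_mult complex_norm_square by simp
    finally show ?thesis .
  qed
  have "(\<lambda>n. 2 * pi * (cmod (\<alpha> n))\<^sup>2) sums circle_integral (\<lambda>\<theta>. (cmod (?u \<theta>))\<^sup>2)"
    using 1 unfolding 2 3 circle_integral_of_real sums_of_real_iff .
  from sums_divide[OF this, of "2*pi"] show ?thesis by simp
qed

text \<open>Pythagoras: \<open>f - F\<close> is orthogonal to the truncation \<open>F\<close> of
  \<open>f\<close> to the modes below \<open>N\<close>, and Parseval evaluates the integral of
  \<open>|F|^2\<close>. Partial sums suit the Gronwall argument, which differentiates finite sums
  only.\<close>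

lemma bessel_inequality:
  assumes f: "continuous_on UNIV f"
  shows "(\<Sum>n<N. (cmod (szego_projector f n))\<^sup>2) \<le> circle_integral (\<lambda>\<theta>. (cmod (f \<theta>))\<^sup>2) / (2 * pi)"
proof -
  \<comment> \<open>Padding with zeros makes the truncation an absolutely summable sequence, so the
    lemmas on \<open>circle_fun\<close> apply to it.\<close>
  define \<gamma> where "\<gamma> n = (if n < N then szego_projector f n else 0)" for n
  have fin: "summable (\<lambda>n. cmod (\<gamma> n))"
    by (rule summable_finite[of "{..<N}"]) (auto simp: \<gamma>_def)
  let ?F = "circle_fun \<gamma>"
  note F = continuous_circle_fun[OF fin]
  have coeff: "fourier_coeff ?F (int n) = \<gamma> n" for n
    by (rule fourier_coeff_circle_fun[OF fin])
  have Feq: "?F \<theta> = (\<Sum>n<N. \<gamma> n * cis (real n * \<theta>))" for \<theta>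
    unfolding circle_fun_def by (rule suminf_finite) (auto simp: \<gamma>_def)
  have orth: "circle_integral (\<lambda>\<theta>. (f \<theta> - ?F \<theta>) * cnj (?F \<theta>)) = 0"
  proof -
    have "circle_integral (\<lambda>\<theta>. (f \<theta> - ?F \<theta>) * cnj (?F \<theta>)) =
      circle_integral (\<lambda>\<theta>. \<Sum>n<N. cnj (\<gamma> n) * ((f \<theta> - ?F \<theta>) * cis (- (of_int (int n) * \<theta>))))"
    proof (intro arg_cong[where f = circle_integral] ext)
      fix \<theta>
      have "cnj (?F \<theta>) = (\<Sum>n<N. cnj (\<gamma> n) * cis (- (of_int (int n) * \<theta>)))"
        unfolding Feq by (simp add: cis_cnj)
      then show "(f \<theta> - ?F \<theta>) * cnj (?F \<theta>) = (\<Sum>n<N. cnj (\<gamma> n) * ((f \<theta> - ?F \<theta>) * cis (- (of_int (int n) * \<theta>))))"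
        by (simp only: sum_distrib_left mult_ac)
    qed
    also have "\<dots> = (\<Sum>n<N. circle_integral (\<lambda>\<theta>. cnj (\<gamma> n) * ((f \<theta> - ?F \<theta>) * cis (- (of_int (int n) * \<theta>)))))"
      unfolding set_lebesgue_integral_def scaleR_sum_right
      by (rule Bochner_Integration.integral_sum, rule circle_integrable[unfolded set_integrable_def])
         (intro continuous_intros f F)
    also have "\<dots> = (\<Sum>n<N. cnj (\<gamma> n) * (of_real (2*pi) * fourier_coeff (\<lambda>\<theta>. f \<theta> - ?F \<theta>) (int n)))"
      by (simp add: fourier_coeff_def)
    also have "\<dots> = 0"
    proof (rule sum.neutral, intro ballI)
      fix n assume "n \<in> {..<N}"
      then have "fourier_coeff f (int n) = \<gamma> n"
        by (simp add: \<gamma>_def szego_projector_def)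
      then show "cnj (\<gamma> n) * (of_real (2*pi) * fourier_coeff (\<lambda>\<theta>. f \<theta> - ?F \<theta>) (int n)) = 0"
        by (simp add: fourier_coeff_diff[OF f F] coeff)
    qed
    finally show ?thesis .
  qed
  have "(\<lambda>n. (cmod (\<gamma> n))\<^sup>2) sums (\<Sum>n<N. (cmod (\<gamma> n))\<^sup>2)"
    by (rule sums_finite) (auto simp: \<gamma>_def)
  with parseval_circle_fun[OF fin]
  have P: "circle_integral (\<lambda>\<theta>. (cmod (?F \<theta>))\<^sup>2) / (2 * pi) = (\<Sum>n<N. (cmod (\<gamma> n))\<^sup>2)"
    by (rule sums_unique2)
  have "(cmod (f \<theta>))\<^sup>2 = (cmod (f \<theta> - ?F \<theta>))\<^sup>2 + 2 * Re ((f \<theta> - ?F \<theta>) * cnj (?F \<theta>)) + (cmod (?F \<theta>))\<^sup>2" for \<theta>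
    by (simp add: cmod_power2) (simp add: power2_eq_square algebra_simps)
  then have "circle_integral (\<lambda>\<theta>. (cmod (f \<theta>))\<^sup>2) = circle_integral (\<lambda>\<theta>. (cmod (f \<theta> - ?F \<theta>))\<^sup>2)
      + 2 * circle_integral (\<lambda>\<theta>. Re ((f \<theta> - ?F \<theta>) * cnj (?F \<theta>))) + circle_integral (\<lambda>\<theta>. (cmod (?F \<theta>))\<^sup>2)"
    by (simp add: circle_integral_add continuous_intros f F)
  also have "circle_integral (\<lambda>\<theta>. Re ((f \<theta> - ?F \<theta>) * cnj (?F \<theta>))) = 0"
    by (subst circle_integral_Re) (auto intro!: continuous_intros f F simp: orth)
  finally have "circle_integral (\<lambda>\<theta>. (cmod (f \<theta>))\<^sup>2) \<ge> circle_integral (\<lambda>\<theta>. (cmod (?F \<theta>))\<^sup>2)"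
    using circle_integral_mono[of "\<lambda>_. 0" "\<lambda>\<theta>. (cmod (f \<theta> - ?F \<theta>))\<^sup>2", OF continuous_on_const]
    by (simp add: continuous_intros f F)
  then have "(\<Sum>n<N. (cmod (\<gamma> n))\<^sup>2) \<le> circle_integral (\<lambda>\<theta>. (cmod (f \<theta>))\<^sup>2) / (2 * pi)"
    unfolding P[symmetric] by (intro divide_right_mono) auto
  then show ?thesis
    by (simp add: \<gamma>_def)
qed

section \<open>Uniqueness of solutions\<close>

lemma sobolev_weight_ge_1: "s \<ge> 0 \<Longrightarrow> 1 \<le> (1 + real n) powr (2 * s)"
  by (rule ge_one_powr_ge_zero) auto

lemma sobolev_norm_sums:
  assumes "\<alpha> \<in> sobolev_plus s"
  shows "(\<lambda>n. (1 + real n) powr (2 * s) * (cmod (\<alpha> n))\<^sup>2) sums (sobolev_norm s \<alpha>)\<^sup>2"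
proof -
  have sm: "summable (\<lambda>n. (1 + real n) powr (2 * s) * (cmod (\<alpha> n))\<^sup>2)"
    using assms by (simp add: sobolev_plus_def)
  then have "(sobolev_norm s \<alpha>)\<^sup>2 = (\<Sum>n. (1 + real n) powr (2 * s) * (cmod (\<alpha> n))\<^sup>2)"
    unfolding sobolev_norm_def by (intro real_sqrt_pow2 suminf_nonneg) auto
  with sm show ?thesis
    by (simp add: summable_sums)
qed

lemma sobolev_l2_sums:
  assumes "\<alpha> \<in> sobolev_plus s" "s \<ge> 0"
  shows "summable (\<lambda>n. (cmod (\<alpha> n))\<^sup>2)" "(\<Sum>n. (cmod (\<alpha> n))\<^sup>2) \<le> (sobolev_norm s \<alpha>)\<^sup>2"
proof -
  have le: "(cmod (\<alpha> n))\<^sup>2 \<le> (1 + real n) powr (2 * s) * (cmod (\<alpha> n))\<^sup>2" for n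
    using mult_right_mono[OF sobolev_weight_ge_1[OF assms(2)], of "(cmod (\<alpha> n))\<^sup>2" n] by simp
  note S = sobolev_norm_sums[OF assms(1)]
  show "summable (\<lambda>n. (cmod (\<alpha> n))\<^sup>2)"
    by (rule summable_comparison_test'[OF sums_summable[OF S], of 0]) (use le in simp)
  then show "(\<Sum>n. (cmod (\<alpha> n))\<^sup>2) \<le> (sobolev_norm s \<alpha>)\<^sup>2"
    using suminf_le[OF le _ sums_summable[OF S]] sums_unique[OF S] by simp
qed

lemma cmod_le_sobolev_norm:
  assumes "\<alpha> \<in> sobolev_plus s" "s \<ge> 0"
  shows "cmod (\<alpha> n) \<le> sobolev_norm s \<alpha>"
proof (rule power2_le_imp_le)
  have "(cmod (\<alpha> n))\<^sup>2 = (\<Sum>k\<in>{n}. (cmod (\<alpha> k))\<^sup>2)" by simp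
  also have "\<dots> \<le> (\<Sum>k. (cmod (\<alpha> k))\<^sup>2)"
    by (rule sum_le_suminf[OF sobolev_l2_sums(1)[OF assms]]) auto
  finally show "(cmod (\<alpha> n))\<^sup>2 \<le> (sobolev_norm s \<alpha>)\<^sup>2"
    using sobolev_l2_sums(2)[OF assms] by simp
  show "0 \<le> sobolev_norm s \<alpha>"
    unfolding sobolev_norm_def using assms(1)
    by (intro real_sqrt_ge_zero suminf_nonneg) (auto simp: sobolev_plus_def)
qed

lemma cmod_add_power2_le: "(cmod (a + b))\<^sup>2 \<le> 2 * (cmod a)\<^sup>2 + 2 * (cmod b)\<^sup>2"
proof -
  have "(cmod (a + b))\<^sup>2 \<le> (cmod a + cmod b)\<^sup>2"
    by (intro power_mono norm_triangle_ineq) auto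
  then show ?thesis
    using sum_squares_bound[of "cmod a" "cmod b"] by (simp add: power2_sum)
qed

lemma cmod_diff_power2_le: "(cmod (a - b))\<^sup>2 \<le> 2 * (cmod a)\<^sup>2 + 2 * (cmod b)\<^sup>2"
  using cmod_add_power2_le[of a "- b"] by simp

lemma sobolev_plus_diff:
  assumes "\<alpha> \<in> sobolev_plus s" "\<gamma> \<in> sobolev_plus s"
  shows "(\<lambda>n. \<alpha> n - \<gamma> n) \<in> sobolev_plus s"
proof -
  let ?w = "\<lambda>n. (1 + real n) powr (2 * s)"
  have le: "?w n * (cmod (\<alpha> n - \<gamma> n))\<^sup>2 \<le> 2 * (?w n * (cmod (\<alpha> n))\<^sup>2) + 2 * (?w n * (cmod (\<gamma> n))\<^sup>2)" for n
    using mult_left_mono[OF cmod_diff_power2_le, of "?w n" "\<alpha> n" "\<gamma> n"] by (simp add: algebra_simps)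
  have "summable (\<lambda>n. 2 * (?w n * (cmod (\<alpha> n))\<^sup>2) + 2 * (?w n * (cmod (\<gamma> n))\<^sup>2))"
    using assms by (intro summable_add summable_mult) (auto simp: sobolev_plus_def)
  then show ?thesis
    unfolding sobolev_plus_def mem_Collect_eq
    by (rule summable_comparison_test'[where N = 0]) (use le in simp)
qed

lemma sobolev_plus_divide:
  assumes "\<alpha> \<in> sobolev_plus s"
  shows "(\<lambda>n. \<alpha> n / c) \<in> sobolev_plus s"
proof -
  have "summable (\<lambda>n. (1 + real n) powr (2 * s) * (cmod (\<alpha> n))\<^sup>2 / (cmod c)\<^sup>2)"
    using assms by (intro summable_divide) (auto simp: sobolev_plus_def)
  then show ?thesis
    by (simp add: sobolev_plus_def norm_divide power_divide)
qed

text \<open>The elementary bound \<open>x \<le> 1/w + w x^2\<close>, with \<open>w\<close> the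
  Sobolev weight, stands in for Cauchy-Schwarz; \<open>2 * s > 1\<close> makes the sum of
  \<open>1/w\<close> converge. The estimate is quadratic in the norm, and later it only serves to
  bound the sum on bounded sets of H^s.\<close>

lemma sobolev_abs_summable:
  assumes "\<alpha> \<in> sobolev_plus s" "s > 1/2"
  shows "summable (\<lambda>n. cmod (\<alpha> n))"
    "(\<Sum>n. cmod (\<alpha> n)) \<le> (\<Sum>n. (1 + real n) powr (- (2 * s))) + (sobolev_norm s \<alpha>)\<^sup>2"
proof -
  note S = sobolev_norm_sums[OF assms(1)]
  have "summable (\<lambda>n. real (Suc n) powr (- (2 * s)))"
    by (subst summable_Suc_iff) (use assms(2) in \<open>simp add: summable_real_powr_iff\<close>)
  then have Z: "summable (\<lambda>n. (1 + real n) powr (- (2 * s)))" by simp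
  have le: "cmod (\<alpha> n) \<le> (1 + real n) powr (- (2 * s)) + (1 + real n) powr (2 * s) * (cmod (\<alpha> n))\<^sup>2" for n
  proof -
    define w where "w = (1 + real n) powr (2 * s)"
    have w: "w > 0" by (simp add: w_def)
    have "0 \<le> (w * cmod (\<alpha> n) - 1)\<^sup>2 / w + cmod (\<alpha> n)"
      using w by simp
    also have "\<dots> = w * (cmod (\<alpha> n))\<^sup>2 + inverse w - cmod (\<alpha> n)"
      using w by (simp add: field_simps power2_eq_square)
    finally show ?thesis
      by (simp add: w_def powr_minus)
  qed
  show 1: "summable (\<lambda>n. cmod (\<alpha> n))"
    by (rule summable_comparison_test'[OF summable_add[OF Z sums_summable[OF S]], of 0]) (use le in simp)
  have "(\<Sum>n. cmod (\<alpha> n)) \<le> (\<Sum>n. (1 + real n) powr (- (2 * s)) + (1 + real n) powr (2 * s) * (cmod (\<alpha> n))\<^sup>2)"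
    by (rule suminf_le[OF le 1 summable_add[OF Z sums_summable[OF S]]])
  also have "\<dots> = (\<Sum>n. (1 + real n) powr (- (2 * s))) + (sobolev_norm s \<alpha>)\<^sup>2"
    using suminf_add[OF Z sums_summable[OF S]] sums_unique[OF S] by simp
  finally show "(\<Sum>n. cmod (\<alpha> n)) \<le> (\<Sum>n. (1 + real n) powr (- (2 * s))) + (sobolev_norm s \<alpha>)\<^sup>2" .
qed

section \<open>Lipschitz bounds for the vector field in L^2\<close>

lemma cubic_lipschitz:
  assumes "cmod (f \<theta>) \<le> M" "cmod (g \<theta>) \<le> M"
  shows "cmod (cubic f \<theta> - cubic g \<theta>) \<le> 3 * M\<^sup>2 * cmod (f \<theta> - g \<theta>)"
proof -
  let ?a = "f \<theta>" and ?b = "g \<theta>"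
  have M: "0 \<le> M" using assms(1) norm_ge_zero order_trans by blast
  have eq: "cubic f \<theta> - cubic g \<theta> =
      of_real ((cmod ?a)\<^sup>2) * (?a - ?b) + of_real ((cmod ?a - cmod ?b) * (cmod ?a + cmod ?b)) * ?b"
    by (simp add: cubic_def algebra_simps power2_eq_square)
  have "cmod (cubic f \<theta> - cubic g \<theta>) \<le> (cmod ?a)\<^sup>2 * cmod (?a - ?b) + \<bar>cmod ?a - cmod ?b\<bar> * (cmod ?a + cmod ?b) * cmod ?b"
    unfolding eq by (rule order_trans[OF norm_triangle_ineq])
      (simp only: norm_mult norm_of_real abs_mult, simp)
  also have "\<dots> \<le> M\<^sup>2 * cmod (?a - ?b) + cmod (?a - ?b) * (M + M) * M"
    using assms M norm_triangle_ineq3[of ?a ?b]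
    by (intro add_mono mult_mono power_mono) auto
  finally show ?thesis by (simp add: power2_eq_square algebra_simps)
qed

lemma cmod_circle_fun_le:
  assumes "summable (\<lambda>n. cmod (\<alpha> n))"
  shows "cmod (circle_fun \<alpha> \<theta>) \<le> (\<Sum>n. cmod (\<alpha> n))"
  unfolding circle_fun_def using assms
  by (intro order_trans[OF summable_norm]) (auto simp: norm_mult)

lemma circle_fun_diff:
  assumes "summable (\<lambda>n. cmod (\<alpha> n))" "summable (\<lambda>n. cmod (\<gamma> n))"
  shows "circle_fun (\<lambda>n. \<alpha> n - \<gamma> n) \<theta> = circle_fun \<alpha> \<theta> - circle_fun \<gamma> \<theta>"
proof -
  have "summable (\<lambda>n. \<alpha> n * cis (real n * \<theta>))" "summable (\<lambda>n. \<gamma> n * cis (real n * \<theta>))"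
    by (rule summable_norm_cancel, simp add: norm_mult assms)+
  from suminf_diff[OF this] show ?thesis
    by (simp add: circle_fun_def left_diff_distrib)
qed

lemma continuous_cubic: "continuous_on S f \<Longrightarrow> continuous_on S (cubic f)"
  unfolding cubic_def by (intro continuous_intros)

text \<open>Bessel removes the projector, the pointwise estimate with sup bound \<open>M\<close>
  contributes the square of \<open>3 * M^2\<close>, and Parseval leads from the integral back to
  coefficients.\<close>

lemma szego_cubic_lipschitz:
  assumes \<alpha>: "summable (\<lambda>n. cmod (\<alpha> n))" "(\<Sum>n. cmod (\<alpha> n)) \<le> M"
    and \<gamma>: "summable (\<lambda>n. cmod (\<gamma> n))" "(\<Sum>n. cmod (\<gamma> n)) \<le> M"
  shows "(\<Sum>n<N. (cmod (szego_projector (cubic (circle_fun \<alpha>)) n - szego_projector (cubic (circle_fun \<gamma>)) n))\<^sup>2)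
    \<le> 9 * M ^ 4 * (\<Sum>n. (cmod (\<alpha> n - \<gamma> n))\<^sup>2)"
proof -
  let ?f = "circle_fun \<alpha>" and ?g = "circle_fun \<gamma>"
  define w where "w n = \<alpha> n - \<gamma> n" for n
  have w: "summable (\<lambda>n. cmod (w n))"
    unfolding w_def by (rule summable_comparison_test'[OF summable_add[OF \<alpha>(1) \<gamma>(1)], of 0])
      (simp add: norm_triangle_ineq4)
  note c = continuous_circle_fun[OF \<alpha>(1)] continuous_circle_fun[OF \<gamma>(1)] continuous_circle_fun[OF w]
  note cc = continuous_cubic[OF c(1)] continuous_cubic[OF c(2)]
  have le: "(cmod (cubic ?f \<theta> - cubic ?g \<theta>))\<^sup>2 \<le> 9 * M ^ 4 * (cmod (circle_fun w \<theta>))\<^sup>2" for \<theta>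
  proof -
    have "cmod (cubic ?f \<theta> - cubic ?g \<theta>) \<le> 3 * M\<^sup>2 * cmod (circle_fun w \<theta>)"
      unfolding w_def circle_fun_diff[OF \<alpha>(1) \<gamma>(1)]
      by (intro cubic_lipschitz order_trans[OF cmod_circle_fun_le] \<alpha> \<gamma>)
    from power_mono[OF this, of 2] show ?thesis
      by (simp add: power_mult_distrib flip: power_mult)
  qed
  have "szego_projector (cubic ?f) n - szego_projector (cubic ?g) n = szego_projector (\<lambda>\<theta>. cubic ?f \<theta> - cubic ?g \<theta>) n" for n
    unfolding szego_projector_def by (rule fourier_coeff_diff[OF cc, symmetric])
  then have "(\<Sum>n<N. (cmod (szego_projector (cubic ?f) n - szego_projector (cubic ?g) n))\<^sup>2) \<le>
      circle_integral (\<lambda>\<theta>. (cmod (cubic ?f \<theta> - cubic ?g \<theta>))\<^sup>2) / (2 * pi)"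
    using bessel_inequality[of "\<lambda>\<theta>. cubic ?f \<theta> - cubic ?g \<theta>" N] by (simp add: continuous_intros cc)
  also have "\<dots> \<le> circle_integral (\<lambda>\<theta>. 9 * M ^ 4 * (cmod (circle_fun w \<theta>))\<^sup>2) / (2 * pi)"
    by (intro divide_right_mono circle_integral_mono le continuous_intros cc c) simp
  also have "\<dots> = 9 * M ^ 4 * (circle_integral (\<lambda>\<theta>. (cmod (circle_fun w \<theta>))\<^sup>2) / (2 * pi))"
    by simp
  also have "circle_integral (\<lambda>\<theta>. (cmod (circle_fun w \<theta>))\<^sup>2) / (2 * pi) = (\<Sum>n. (cmod (w n))\<^sup>2)"
    by (rule sums_unique[OF parseval_circle_fun[OF w]])
  finally show ?thesis by (simp add: w_def)
qed

lemma summable_shift_adj: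
  "summable (\<lambda>n. cmod (\<alpha> n)) \<Longrightarrow> summable (\<lambda>n. cmod (shift_adj \<alpha> n))"
  unfolding shift_adj_def by (subst summable_Suc_iff)

lemma suminf_Suc_le:
  fixes f :: "nat \<Rightarrow> real"
  assumes "summable f" "\<And>n. 0 \<le> f n"
  shows "(\<Sum>n. f (Suc n)) \<le> (\<Sum>n. f n)"
  using suminf_split_head[OF assms(1)] assms(2)[of 0] by simp

lemma sum_shift_le:
  "(\<Sum>n<N. (cmod (shift h n - shift k n))\<^sup>2) \<le> (\<Sum>n<N. (cmod (h n - k n))\<^sup>2)"
proof (cases N)
  case (Suc m)
  have "(\<Sum>n<Suc m. (cmod (shift h n - shift k n))\<^sup>2) = (\<Sum>n<m. (cmod (h n - k n))\<^sup>2)"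
    by (simp add: sum.lessThan_Suc_shift[of _ m] shift_def del: sum.lessThan_Suc)
  also have "\<dots> \<le> (\<Sum>n<Suc m. (cmod (h n - k n))\<^sup>2)" by simp
  finally show ?thesis unfolding Suc .
qed simp

text \<open>Neither \<open>shift\<close> nor \<open>shift_adj\<close> increases the sums of squares,
  so both cubic terms obey the same bound, the second with the factor \<open>\<beta>^2\<close>. The
  constant 18 is 9 doubled by \<open>|a - b|^2 \<le> 2 |a|^2 + 2 |b|^2\<close>.\<close>

lemma beta_szego_rhs_lipschitz:
  assumes \<alpha>: "summable (\<lambda>n. cmod (\<alpha> n))" "(\<Sum>n. cmod (\<alpha> n)) \<le> M"
    and \<gamma>: "summable (\<lambda>n. cmod (\<gamma> n))" "(\<Sum>n. cmod (\<gamma> n)) \<le> M"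
    and w: "summable (\<lambda>n. (cmod (\<alpha> n - \<gamma> n))\<^sup>2)"
  shows "(\<Sum>n<N. (cmod (beta_szego_rhs \<beta> \<alpha> n - beta_szego_rhs \<beta> \<gamma> n))\<^sup>2)
    \<le> 18 * (1 + \<beta>\<^sup>2) * M ^ 4 * (\<Sum>n. (cmod (\<alpha> n - \<gamma> n))\<^sup>2)"
proof -
  let ?P = "\<lambda>\<alpha>. szego_projector (cubic (circle_fun \<alpha>))"
  let ?E = "\<Sum>n. (cmod (\<alpha> n - \<gamma> n))\<^sup>2"
  have 1: "(\<Sum>n<N. (cmod (?P \<alpha> n - ?P \<gamma> n))\<^sup>2) \<le> 9 * M ^ 4 * ?E"
    by (rule szego_cubic_lipschitz[OF assms(1-4)])
  have "(\<Sum>n<N. (cmod (shift (?P (shift_adj \<alpha>)) n - shift (?P (shift_adj \<gamma>)) n))\<^sup>2) \<le>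
      (\<Sum>n<N. (cmod (?P (shift_adj \<alpha>) n - ?P (shift_adj \<gamma>) n))\<^sup>2)"
    by (rule sum_shift_le)
  also have "\<dots> \<le> 9 * M ^ 4 * (\<Sum>n. (cmod (shift_adj \<alpha> n - shift_adj \<gamma> n))\<^sup>2)"
    by (rule szego_cubic_lipschitz)
       (use \<alpha> \<gamma> suminf_Suc_le[OF \<alpha>(1)] suminf_Suc_le[OF \<gamma>(1)]
         in \<open>auto simp: summable_shift_adj\<close>, simp_all add: shift_adj_def)
  also have "\<dots> \<le> 9 * M ^ 4 * ?E"
    using suminf_Suc_le[OF w] by (intro mult_left_mono) (simp_all add: shift_adj_def)
  finally have 2: "(\<Sum>n<N. (cmod (shift (?P (shift_adj \<alpha>)) n - shift (?P (shift_adj \<gamma>)) n))\<^sup>2) \<le> 9 * M ^ 4 * ?E" .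
  have "(cmod (beta_szego_rhs \<beta> \<alpha> n - beta_szego_rhs \<beta> \<gamma> n))\<^sup>2 \<le>
      2 * (cmod (?P \<alpha> n - ?P \<gamma> n))\<^sup>2 + 2 * (\<beta>\<^sup>2 * (cmod (shift (?P (shift_adj \<alpha>)) n - shift (?P (shift_adj \<gamma>)) n))\<^sup>2)" for n
  proof -
    have "beta_szego_rhs \<beta> \<alpha> n - beta_szego_rhs \<beta> \<gamma> n = (?P \<alpha> n - ?P \<gamma> n) -
        of_real \<beta> * (shift (?P (shift_adj \<alpha>)) n - shift (?P (shift_adj \<gamma>)) n)"
      by (simp add: beta_szego_rhs_def algebra_simps)
    then show ?thesis
      using cmod_diff_power2_le[of "?P \<alpha> n - ?P \<gamma> n" "of_real \<beta> * (shift (?P (shift_adj \<alpha>)) n - shift (?P (shift_adj \<gamma>)) n)"]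
      by (simp add: norm_mult power_mult_distrib)
  qed
  then have "(\<Sum>n<N. (cmod (beta_szego_rhs \<beta> \<alpha> n - beta_szego_rhs \<beta> \<gamma> n))\<^sup>2) \<le>
      (\<Sum>n<N. 2 * (cmod (?P \<alpha> n - ?P \<gamma> n))\<^sup>2 + 2 * (\<beta>\<^sup>2 * (cmod (shift (?P (shift_adj \<alpha>)) n - shift (?P (shift_adj \<gamma>)) n))\<^sup>2))"
    by (rule sum_mono)
  also have "\<dots> = 2 * (\<Sum>n<N. (cmod (?P \<alpha> n - ?P \<gamma> n))\<^sup>2) +
      2 * (\<beta>\<^sup>2 * (\<Sum>n<N. (cmod (shift (?P (shift_adj \<alpha>)) n - shift (?P (shift_adj \<gamma>)) n))\<^sup>2))"
    by (simp only: sum.distrib sum_distrib_left)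
  also have "\<dots> \<le> 2 * (9 * M ^ 4 * ?E) + 2 * (\<beta>\<^sup>2 * (9 * M ^ 4 * ?E))"
    by (intro add_mono mult_left_mono 1 2) auto
  also have "\<dots> = 18 * (1 + \<beta>\<^sup>2) * M ^ 4 * ?E"
    by (simp add: algebra_simps)
  finally show ?thesis .
qed

section \<open>Regularity of a solution in time, and the Gronwall argument\<close>

lemma solution_coeff_derivative:
  assumes sol: "beta_szego_solution \<beta> s u0 u" and s: "s \<ge> 0"
  shows "((\<lambda>t. u t n) has_vector_derivative - (\<i> * beta_szego_rhs \<beta> (u t) n)) (at t)"
proof -
  obtain D where D: "D \<in> sobolev_plus s" "has_sobolev_derivative s u D t"
      "\<And>n. \<i> * D n = beta_szego_rhs \<beta> (u t) n"
    using sol unfolding beta_szego_solution_def by blast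
  have u: "u t \<in> sobolev_plus s" for t
    using sol unfolding beta_szego_solution_def by blast
  let ?q = "\<lambda>h n. (u (t + h) n - u t n) / of_real h - D n"
  have "cmod (?q h n) \<le> sobolev_norm s (?q h)" for h
    using cmod_le_sobolev_norm[OF sobolev_plus_diff[OF sobolev_plus_divide[OF sobolev_plus_diff[OF u u]] D(1)] s] .
  then have "\<forall>\<^sub>F h in at 0. norm (cmod (?q h n)) \<le> sobolev_norm s (?q h)"
    by (intro always_eventually allI) simp
  then have "((\<lambda>h. cmod (?q h n)) \<longlongrightarrow> 0) (at 0)"
    using D(2)[unfolded has_sobolev_derivative_def] by (rule Lim_null_comparison)
  moreover have "cmod (?q h n) = norm (u (t + h) n - u t n - h *\<^sub>R D n) / norm h" if "h \<noteq> 0" for h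
  proof -
    have "?q h n = (u (t + h) n - u t n - h *\<^sub>R D n) / of_real h"
      using that by (simp add: field_simps scaleR_conv_of_real)
    then show ?thesis by (simp add: norm_divide)
  qed
  ultimately have "((\<lambda>h. norm (u (t + h) n - u t n - h *\<^sub>R D n) / norm h) \<longlongrightarrow> 0) (at 0)"
    by (subst (asm) tendsto_cong[where g = "\<lambda>h. norm (u (t + h) n - u t n - h *\<^sub>R D n) / norm h"])
       (auto simp: eventually_at_filter)
  then have "((\<lambda>t. u t n) has_vector_derivative D n) (at t)"
    unfolding has_vector_derivative_def has_derivative_at
    by (simp add: bounded_linear_scaleR_left)
  moreover have "D n = - (\<i> * beta_szego_rhs \<beta> (u t) n)"
    unfolding D(3)[symmetric] by (simp flip: mult.assoc)
  ultimately show ?thesis by simp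
qed

text \<open>Near \<open>t\<close> one has \<open>u (t + h) = u t + h (q + D)\<close>, where the
  error \<open>q\<close> of the difference quotient has norm below 1. The termwise bound
  \<open>|a + b|^2 \<le> 2 |a|^2 + 2 |b|^2\<close> plays the part of the triangle inequality, whence
  the constants 2 and 4.\<close>

lemma solution_locally_bounded:
  assumes sol: "beta_szego_solution \<beta> s u0 u" and s: "s \<ge> 0"
  shows "\<exists>\<delta>>0. \<exists>C. \<forall>t'. \<bar>t' - t\<bar> < \<delta> \<longrightarrow> (sobolev_norm s (u t'))\<^sup>2 \<le> C"
proof -
  obtain D where D: "D \<in> sobolev_plus s" "has_sobolev_derivative s u D t"
    using sol unfolding beta_szego_solution_def by blast
  have u: "u t \<in> sobolev_plus s" for t
    using sol unfolding beta_szego_solution_def by blast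
  let ?q = "\<lambda>h n. (u (t + h) n - u t n) / of_real h - D n"
  have q: "?q h \<in> sobolev_plus s" for h
    by (rule sobolev_plus_diff[OF sobolev_plus_divide[OF sobolev_plus_diff[OF u u]] D(1)])
  obtain d where d: "d > 0" "\<And>h. h \<noteq> 0 \<Longrightarrow> \<bar>h\<bar> < d \<Longrightarrow> \<bar>sobolev_norm s (?q h)\<bar> < 1"
    using D(2) unfolding has_sobolev_derivative_def LIM_eq by (auto dest: spec[of _ 1])
  define C where "C = 2 * (sobolev_norm s (u t))\<^sup>2 + 4 * (1 + (sobolev_norm s D)\<^sup>2)"
  have "(sobolev_norm s (u (t + h)))\<^sup>2 \<le> C" if h: "\<bar>h\<bar> < min d 1" for h
  proof (cases "h = 0")
    case True
    have "0 \<le> (sobolev_norm s (u t))\<^sup>2" "0 \<le> (sobolev_norm s D)\<^sup>2" by simp_all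
    then show ?thesis using True by (simp add: C_def)
  next
    case False
    let ?w = "\<lambda>n. (1 + real n) powr (2 * s)"
    have le: "?w n * (cmod (u (t + h) n))\<^sup>2 \<le>
        2 * (?w n * (cmod (u t n))\<^sup>2) + (4 * (?w n * (cmod (?q h n))\<^sup>2) + 4 * (?w n * (cmod (D n))\<^sup>2))" for n
    proof -
      have "(cmod (of_real h * (?q h n + D n)))\<^sup>2 = h\<^sup>2 * (cmod (?q h n + D n))\<^sup>2"
        by (simp only: norm_mult norm_of_real power_mult_distrib power2_abs)
      also have "\<dots> \<le> 1 * (cmod (?q h n + D n))\<^sup>2"
        using h by (intro mult_right_mono) (auto simp: abs_square_le_1)
      also have "\<dots> \<le> 2 * (cmod (?q h n))\<^sup>2 + 2 * (cmod (D n))\<^sup>2"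
        unfolding mult_1 by (rule cmod_add_power2_le)
      finally have "(cmod (of_real h * (?q h n + D n)))\<^sup>2 \<le> 2 * (cmod (?q h n))\<^sup>2 + 2 * (cmod (D n))\<^sup>2" .
      moreover have "u (t + h) n = u t n + of_real h * (?q h n + D n)"
        using False by (simp add: field_simps)
      ultimately have "(cmod (u (t + h) n))\<^sup>2 \<le> 2 * (cmod (u t n))\<^sup>2 + (4 * (cmod (?q h n))\<^sup>2 + 4 * (cmod (D n))\<^sup>2)"
        using cmod_add_power2_le[of "u t n" "of_real h * (?q h n + D n)"] by simp
      from mult_left_mono[OF this, of "?w n"] show ?thesis
        by (simp only: distrib_left mult.left_commute powr_ge_zero)
    qed
    have "(sobolev_norm s (u (t + h)))\<^sup>2 \<le> 2 * (sobolev_norm s (u t))\<^sup>2 +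
        (4 * (sobolev_norm s (?q h))\<^sup>2 + 4 * (sobolev_norm s D)\<^sup>2)"
      by (rule sums_le[OF le sobolev_norm_sums[OF u]]) (intro sums_add sums_mult sobolev_norm_sums u q D)
    moreover have "(sobolev_norm s (?q h))\<^sup>2 \<le> 1"
      using d(2)[OF False] h by (simp add: abs_square_le_1)
    ultimately show ?thesis by (simp add: C_def)
  qed
  from this[of "_ - t"] have "\<forall>t'. \<bar>t' - t\<bar> < min d 1 \<longrightarrow> (sobolev_norm s (u t'))\<^sup>2 \<le> C"
    by simp
  moreover have "min d 1 > 0" using d(1) by simp
  ultimately show ?thesis by blast
qed

lemma DERIV_cmod_power2:
  assumes "(f has_vector_derivative f') (at t)"
  shows "((\<lambda>t. (cmod (f t))\<^sup>2) has_real_derivative 2 * (Re (f t) * Re f' + Im (f t) * Im f')) (at t)"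
proof -
  have "((\<lambda>t. Re (f t)) has_real_derivative Re f') (at t)" "((\<lambda>t. Im (f t)) has_real_derivative Im f') (at t)"
    using bounded_linear.has_vector_derivative[OF bounded_linear_Re assms]
      bounded_linear.has_vector_derivative[OF bounded_linear_Im assms]
    by (simp_all add: has_real_derivative_iff_has_vector_derivative)
  from DERIV_add[OF DERIV_power[OF this(1), of 2] DERIV_power[OF this(2), of 2]] show ?thesis
    unfolding cmod_power2 by (rule DERIV_cong) (simp add: algebra_simps)
qed

lemma abs_2_inner_le: "\<bar>2 * (Re a * Re b + Im a * Im b)\<bar> \<le> (cmod a)\<^sup>2 + (cmod b)\<^sup>2"
proof -
  have "0 \<le> (Re a - Re b)\<^sup>2" "0 \<le> (Im a - Im b)\<^sup>2" "0 \<le> (Re a + Re b)\<^sup>2" "0 \<le> (Im a + Im b)\<^sup>2"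
    by simp_all
  then show ?thesis
    unfolding cmod_power2 power2_sum power2_diff by (simp add: abs_le_iff)
qed

text \<open>The times at which two solutions agree form a closed set. It is open as well, because
  near such a time the squared L^2 distance obeys a linear differential inequality; connectedness of
  the real line finishes.\<close>

lemma solution_unique:
  assumes u: "beta_szego_solution \<beta> s u0 u" and v: "beta_szego_solution \<beta> s u0 v" and s: "s > 1/2"
  shows "u = v"
proof -
  have s0: "s \<ge> 0" using s by simp
  have u_in: "u t \<in> sobolev_plus s" and v_in: "v t \<in> sobolev_plus s" for t
    using u v unfolding beta_szego_solution_def by blast+
  define w where "w t n = u t n - v t n" for t n
  define w' where "w' t n = - (\<i> * beta_szego_rhs \<beta> (u t) n) - - (\<i> * beta_szego_rhs \<beta> (v t) n)" for t n
  have dw: "((\<lambda>t. w t n) has_vector_derivative w' t n) (at t)" for t n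
    unfolding w_def w'_def
    by (intro has_vector_derivative_diff solution_coeff_derivative[OF u s0] solution_coeff_derivative[OF v s0])
  have w_in: "w t \<in> sobolev_plus s" for t
    using sobolev_plus_diff[OF u_in v_in] by (simp add: w_def[abs_def])
  note w_l2 = sobolev_l2_sums(1)[OF w_in s0]
  define Z where "Z = {t. u t = v t}"
  have "Z = (\<Inter>n. {t. w t n = 0})"
    by (auto simp: Z_def w_def)
  moreover have "closed {t. w t n = 0}" for n
  proof (intro closed_Collect_eq continuous_on_const continuous_at_imp_continuous_on ballI)
    show "isCont (\<lambda>t. w t n) t" for t
      by (rule has_vector_derivative_continuous[OF dw])
  qed
  ultimately have closed: "closed Z" by auto
  have "\<exists>\<delta>>0. \<forall>t. dist t t0 < \<delta> \<longrightarrow> t \<in> Z" if t0: "t0 \<in> Z" for t0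
  proof -
    obtain d1 C1 where 1: "d1 > 0" "\<And>t. \<bar>t - t0\<bar> < d1 \<Longrightarrow> (sobolev_norm s (u t))\<^sup>2 \<le> C1"
      using solution_locally_bounded[OF u s0, of t0] by auto
    obtain d2 C2 where 2: "d2 > 0" "\<And>t. \<bar>t - t0\<bar> < d2 \<Longrightarrow> (sobolev_norm s (v t))\<^sup>2 \<le> C2"
      using solution_locally_bounded[OF v s0, of t0] by auto
    define C where "C = max C1 C2"
    define M where "M = (\<Sum>n. (1 + real n) powr (- (2 * s))) + C"
    define L where "L = 18 * (1 + \<beta>\<^sup>2) * M ^ 4"
    have L: "L \<ge> 0" by (simp add: L_def)
    \<comment> \<open>The radius gives \<open>(1 + L) * \<delta> \<le> 1/2\<close>: any bound on the
      squared distance over the whole ball is then halved by the mean value inequality from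
      \<open>t0\<close>, and iterating sends it to 0.\<close>
    define \<delta> where "\<delta> = min (min d1 d2) (1 / (2 * (1 + L)))"
    have \<delta>: "\<delta> > 0" "\<delta> \<le> d1" "\<delta> \<le> d2" "(1 + L) * \<delta> \<le> 1 / 2"
    proof -
      have "(1 + L) * \<delta> \<le> (1 + L) * (1 / (2 * (1 + L)))"
        unfolding \<delta>_def using L by (intro mult_left_mono) auto
      also have "\<dots> = 1 / 2" using L by (simp add: field_simps)
      finally show "(1 + L) * \<delta> \<le> 1 / 2" .
    qed (use 1 2 L in \<open>auto simp: \<delta>_def\<close>)
    let ?E = "\<lambda>t. \<Sum>n. (cmod (w t n))\<^sup>2"
    have bound: "?E t \<le> 4 * C / 2 ^ k" if "t \<in> ball t0 \<delta>" for t k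
      using that
    proof (induction k arbitrary: t)
      case 0
      then have t: "\<bar>t - t0\<bar> < d1" "\<bar>t - t0\<bar> < d2" using \<delta> by (auto simp: dist_real_def)
      have "?E t \<le> (\<Sum>n. 2 * (cmod (u t n))\<^sup>2 + 2 * (cmod (v t n))\<^sup>2)"
        unfolding w_def
        by (intro suminf_le cmod_diff_power2_le w_l2[unfolded w_def] summable_add summable_mult
            sobolev_l2_sums(1)[OF u_in s0] sobolev_l2_sums(1)[OF v_in s0])
      also have "\<dots> = 2 * (\<Sum>n. (cmod (u t n))\<^sup>2) + 2 * (\<Sum>n. (cmod (v t n))\<^sup>2)"
      proof -
        note sums = sobolev_l2_sums(1)[OF u_in s0, of t] sobolev_l2_sums(1)[OF v_in s0, of t]
        show ?thesis
          using suminf_add[OF summable_mult[OF sums(1), of 2] summable_mult[OF sums(2), of 2]]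
          by (simp only: suminf_mult[OF sums(1)] suminf_mult[OF sums(2)])
      qed
      also have "\<dots> \<le> 2 * C + 2 * C"
        using sobolev_l2_sums(2)[OF u_in s0, of t] sobolev_l2_sums(2)[OF v_in s0, of t] 1(2)[OF t(1)] 2(2)[OF t(2)]
        by (simp add: C_def)
      finally show ?case by simp
    next
      case (Suc k)
      define E where "E = 4 * C / 2 ^ k"
      have E: "?E t \<le> E" if "t \<in> ball t0 \<delta>" for t
        unfolding E_def by (rule Suc.IH[OF that])
      \<comment> \<open>Derivatives are known coefficient by coefficient, so finite sums are
        differentiated; the bound \<open>(1 + L) * E\<close> is independent of \<open>N\<close> and
        therefore passes to the series.\<close>
      have "(\<Sum>n<N. (cmod (w t n))\<^sup>2) \<le> E / 2" for N
      proof -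
        let ?W = "\<lambda>t. \<Sum>n<N. (cmod (w t n))\<^sup>2"
        let ?W' = "\<lambda>t. \<Sum>n<N. 2 * (Re (w t n) * Re (w' t n) + Im (w t n) * Im (w' t n))"
        have "(?W has_real_derivative ?W' x) (at x within ball t0 \<delta>)" for x
          by (intro DERIV_sum has_field_derivative_at_within[OF DERIV_cmod_power2[OF dw]])
        moreover have "norm (?W' x) \<le> (1 + L) * E" if x: "x \<in> ball t0 \<delta>" for x
        proof -
          have x': "\<bar>x - t0\<bar> < d1" "\<bar>x - t0\<bar> < d2" using \<delta> x by (auto simp: dist_real_def)
          have w'_eq: "cmod (w' x n) = cmod (beta_szego_rhs \<beta> (u x) n - beta_szego_rhs \<beta> (v x) n)" for n
          proof -
            have "w' x n = - \<i> * (beta_szego_rhs \<beta> (u x) n - beta_szego_rhs \<beta> (v x) n)"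
              by (simp add: w'_def algebra_simps)
            then show ?thesis by (simp add: norm_mult)
          qed
          have "norm (?W' x) \<le> (\<Sum>n<N. (cmod (w x n))\<^sup>2 + (cmod (w' x n))\<^sup>2)"
            by (rule order_trans[OF norm_sum sum_mono]) (simp only: real_norm_def abs_2_inner_le)
          also have "\<dots> = (\<Sum>n<N. (cmod (w x n))\<^sup>2) + (\<Sum>n<N. (cmod (w' x n))\<^sup>2)"
            by (rule sum.distrib)
          also have "(\<Sum>n<N. (cmod (w x n))\<^sup>2) \<le> ?E x"
            by (intro sum_le_suminf w_l2) auto
          also have "(\<Sum>n<N. (cmod (w' x n))\<^sup>2) \<le> L * ?E x"
            unfolding L_def w_def w'_eq
            using sobolev_abs_summable[OF u_in s, of x] sobolev_abs_summable[OF v_in s, of x]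
              1(2)[OF x'(1)] 2(2)[OF x'(2)] w_l2[unfolded w_def]
            by (intro beta_szego_rhs_lipschitz) (auto simp: M_def C_def)
          also have "?E x + L * ?E x = (1 + L) * ?E x" by (simp add: algebra_simps)
          also have "\<dots> \<le> (1 + L) * E"
            using L by (intro mult_left_mono E[OF x]) auto
          finally show ?thesis by simp
        qed
        ultimately have "norm (?W t - ?W t0) \<le> (1 + L) * E * norm (t - t0)"
          using Suc.prems \<delta>(1) by (intro field_differentiable_bound[of "ball t0 \<delta>"]) auto
        moreover have "?W t0 = 0"
          using t0 by (simp add: Z_def w_def)
        moreover have "norm (t - t0) \<le> \<delta>"
          using Suc.prems by (simp add: dist_real_def)
        moreover have E0: "0 \<le> E"
          using order_trans[OF suminf_nonneg[OF w_l2] E[OF Suc.prems]] by simp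
        then have "(1 + L) * E * norm (t - t0) \<le> (1 + L) * E * \<delta>"
          using L \<open>norm (t - t0) \<le> \<delta>\<close> by (intro mult_left_mono) auto
        moreover have "(1 + L) * E * \<delta> \<le> E / 2"
          using mult_right_mono[OF \<delta>(4) E0] by (simp add: mult_ac)
        ultimately show ?thesis by simp
      qed
      then have "?E t \<le> E / 2"
        by (intro suminf_le_const w_l2)
      then show ?case by (simp add: E_def)
    qed
    have "t \<in> Z" if t: "t \<in> ball t0 \<delta>" for t
    proof -
      have "(\<lambda>k. 4 * C * (1 / 2) ^ k) \<longlonglongrightarrow> 4 * C * 0"
        by (intro tendsto_intros LIMSEQ_power_zero) simp
      then have "(\<lambda>k. 4 * C / 2 ^ k) \<longlonglongrightarrow> 0"
        by (simp add: power_one_over)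
      then have "?E t \<le> 0"
        using bound[OF t] by (intro tendsto_lowerbound) (auto intro: always_eventually)
      then have "?E t = 0"
        using suminf_nonneg[OF w_l2, of t] by simp
      then have "\<forall>n. (cmod (w t n))\<^sup>2 = 0"
        by (subst (asm) suminf_eq_zero_iff[OF w_l2]) auto
      then show ?thesis by (auto simp: Z_def w_def)
    qed
    then show ?thesis using \<delta>(1) by (auto simp: dist_commute intro!: exI[of _ \<delta>])
  qed
  then have "open Z"
    unfolding open_dist by blast
  moreover have "0 \<in> Z"
    using u v by (simp add: Z_def beta_szego_solution_def)
  ultimately have "Z = UNIV"
    using closed clopen by blast
  then show ?thesis by (auto simp: Z_def)
qed

section \<open>The rational ansatz\<close>

lemma powr_le_exp:
  fixes a z :: real
  assumes "a > 0" "z > 0"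
  shows "z powr a \<le> (2 * a) powr a * exp (z / 2)"
proof -
  have "ln (z / (2 * a)) \<le> z / (2 * a) - 1"
    using assms by (intro ln_le_minus_one) simp
  then have "ln z - ln (2 * a) \<le> z / (2 * a)"
    using assms by (simp add: ln_div)
  then have "a * (ln z - ln (2 * a)) \<le> a * (z / (2 * a))"
    using assms by (intro mult_left_mono) auto
  then have "a * ln z \<le> a * ln (2 * a) + z / 2"
    using assms by (simp add: algebra_simps)
  then have "exp (a * ln z) \<le> exp (a * ln (2 * a) + z / 2)"
    by simp
  then show ?thesis
    using assms by (simp add: powr_def exp_add)
qed

text \<open>With \<open>y = 1 - x\<close>, \<open>powr_le_exp\<close> at
  \<open>z = (1 + n) y\<close> lets the weight consume only half of the decay
  \<open>x ^ n \<le> exp (- n y)\<close>. What remains is a geometric series of ratio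
  \<open>exp (- y / 2)\<close>, with sum at most \<open>3 / y\<close>. The constant 6 is
  \<open>3 * exp (1 / 2)\<close> rounded up.\<close>

lemma powr_geometric_series_upper:
  assumes a: "a > 0" and x: "0 \<le> x" "x < 1"
  shows "summable (\<lambda>n. (1 + real n) powr a * x ^ n)" (is ?S)
    and "(\<Sum>n. (1 + real n) powr a * x ^ n) \<le> 6 * (2 * a) powr a * (1 - x) powr - (a + 1)" (is ?B)
proof -
  define y where "y = 1 - x"
  have y: "0 < y" "y \<le> 1" using x by (auto simp: y_def)
  define K where "K = y powr - a * ((2 * a) powr a * exp (1 / 2))"
  define r where "r = exp (- y / 2)"
  have K: "K \<ge> 0" by (simp add: K_def)
  have r: "0 < r" "r < 1" using y by (auto simp: r_def)
  have le: "(1 + real n) powr a * x ^ n \<le> K * r ^ n" for n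
  proof -
    have "x \<le> exp (- y)"
      using exp_ge_add_one_self[of "- y"] by (simp add: y_def)
    then have xn: "x ^ n \<le> exp (- y) ^ n"
      using x by (intro power_mono) auto
    have "((1 + real n) * y) powr a \<le> (2 * a) powr a * exp ((1 + real n) * y / 2)"
      using y by (intro powr_le_exp a mult_pos_pos) auto
    also have "\<dots> = (2 * a) powr a * (exp (y / 2) * exp (real n * (y / 2)))"
      by (simp add: field_simps flip: exp_add)
    also have "\<dots> \<le> (2 * a) powr a * (exp (1 / 2) * exp (real n * (y / 2)))"
      using y by (intro mult_left_mono mult_right_mono) auto
    finally have "(1 + real n) powr a * y powr a \<le> (2 * a) powr a * (exp (1 / 2) * exp (real n * (y / 2)))"
      using y by (simp add: powr_mult)
    then have "y powr - a * ((1 + real n) powr a * y powr a) \<le> y powr - a * ((2 * a) powr a * (exp (1 / 2) * exp (real n * (y / 2))))"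
      by (intro mult_left_mono) auto
    moreover have "y powr - a * ((1 + real n) powr a * y powr a) = (1 + real n) powr a"
      using y by (simp add: powr_minus)
    ultimately have "(1 + real n) powr a \<le> K * exp (real n * (y / 2))"
      by (simp add: K_def mult.assoc)
    with xn have "(1 + real n) powr a * x ^ n \<le> K * exp (real n * (y / 2)) * exp (- y) ^ n"
      using K x by (intro mult_mono) auto
    also have "\<dots> = K * r ^ n"
      by (simp add: r_def field_simps flip: exp_of_nat_mult exp_add)
    finally show ?thesis .
  qed
  have G: "summable (\<lambda>n. K * r ^ n)"
    using r by (intro summable_mult summable_geometric) simp
  show S: ?S
    by (rule summable_comparison_test'[OF G, of 0]) (use le x in simp)
  have "(\<Sum>n. (1 + real n) powr a * x ^ n) \<le> (\<Sum>n. K * r ^ n)"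
    by (rule suminf_le[OF le S G])
  also have "\<dots> = K / (1 - r)"
    using r by (simp add: suminf_mult suminf_geometric summable_geometric)
  also have "\<dots> \<le> K / (y / 3)"
  proof (rule divide_left_mono)
    have "(1 - y / 3) * exp (y / 2) \<ge> (1 - y / 3) * (1 + y / 2)"
      using y exp_ge_add_one_self[of "y / 2"] by (intro mult_left_mono) auto
    moreover have "(1 - y / 3) * (1 + y / 2) = 1 + y * (1 - y) / 6"
      by (simp add: field_simps)
    moreover have "y * (1 - y) \<ge> 0" using y by simp
    ultimately have "1 \<le> (1 - y / 3) * exp (y / 2)" by simp
    then have "r * 1 \<le> r * ((1 - y / 3) * exp (y / 2))"
      using r by (intro mult_left_mono) auto
    also have "\<dots> = 1 - y / 3"
      by (simp add: r_def exp_minus field_simps)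
    finally show "y / 3 \<le> 1 - r" by simp
  qed (use y r K in auto)
  also have "\<dots> = (2 * a) powr a * (3 * exp (1 / 2)) * (y powr - a * (1 / y))"
    by (simp add: K_def)
  also have "y powr - a * (1 / y) = y powr - (a + 1)"
    using y by (simp add: powr_diff powr_minus divide_simps powr_add)
  also have "(2 * a) powr a * (3 * exp (1 / 2)) * y powr - (a + 1) \<le> (2 * a) powr a * 6 * y powr - (a + 1)"
  proof (intro mult_right_mono mult_left_mono)
    have "exp (1 / 2 :: real) ^ 2 \<le> 2 ^ 2"
      using exp_le by (simp flip: exp_of_nat_mult)
    then show "3 * exp (1 / 2) \<le> (6::real)"
      using power2_le_imp_le[of "exp (1/2 :: real)" 2] by simp
  qed auto
  finally show ?B by (simp add: y_def mult_ac)
qed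

text \<open>The \<open>m\<close> terms with index from \<open>m\<close> to \<open>2 m - 1\<close>,
  where \<open>m\<close> is about \<open>1 / y\<close>, already have the right total size: the
  weight is at least \<open>y powr - a\<close>, and \<open>x ^ n \<ge> exp (- 6)\<close> because
  \<open>x \<ge> exp (- 2 y)\<close> and \<open>2 n y \<le> 4 + 4 y \<le> 6\<close>.\<close>

lemma powr_geometric_series_lower:
  assumes a: "a > 0" and x: "1 / 2 \<le> x" "x < 1"
  shows "exp (- 6) * (1 - x) powr - (a + 1) \<le> (\<Sum>n. (1 + real n) powr a * x ^ n)"
proof -
  define y where "y = 1 - x"
  have y: "0 < y" "y \<le> 1 / 2" using x by (auto simp: y_def)
  define m where "m = nat \<lceil>1 / y\<rceil>"
  have m: "1 / y \<le> real m" "real m \<le> 1 / y + 1"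
  proof -
    have "0 < 1 / y" using y by simp
    then show "1 / y \<le> real m" "real m \<le> 1 / y + 1"
      unfolding m_def by linarith+
  qed
  have "exp (- (2 * y)) \<le> x"
  proof -
    have "1 \<le> (1 - y) * (1 + 2 * y)"
      using y by (simp add: algebra_simps)
    also have "\<dots> \<le> (1 - y) * exp (2 * y)"
      using y exp_ge_add_one_self[of "2 * y"] by (intro mult_left_mono) auto
    finally have "exp (- (2 * y)) * 1 \<le> exp (- (2 * y)) * ((1 - y) * exp (2 * y))"
      by (intro mult_left_mono) auto
    also have "\<dots> = 1 - y" by (simp add: exp_minus)
    finally show ?thesis by (simp add: y_def)
  qed
  have block: "(1 / y) powr a * exp (- 6) \<le> (1 + real n) powr a * x ^ n" if n: "n \<in> {m..<2 * m}" for n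
  proof (rule mult_mono)
    show "(1 / y) powr a \<le> (1 + real n) powr a"
      using n m(1) y a by (intro powr_mono2) auto
    have "real n * (2 * y) \<le> (2 * (1 / y + 1)) * (2 * y)"
      using n m y by (intro mult_right_mono) auto
    also have "\<dots> = 4 + 4 * y" using y by (simp add: field_simps)
    also have "\<dots> \<le> 6" using y by simp
    finally have "exp (- 6) \<le> exp (- (2 * y)) ^ n"
      by (simp flip: exp_of_nat_mult)
    also have "\<dots> \<le> x ^ n"
      using \<open>exp (- (2 * y)) \<le> x\<close> by (intro power_mono) auto
    finally show "exp (- 6) \<le> x ^ n" .
  qed auto
  have "exp (- 6) * y powr - (a + 1) = (1 / y) * ((1 / y) powr a * exp (- 6))"
    using y by (simp add: powr_diff powr_minus divide_simps powr_add powr_divide)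
  also have "\<dots> \<le> real m * ((1 / y) powr a * exp (- 6))"
    using m y by (intro mult_right_mono) auto
  also have "\<dots> = (\<Sum>n\<in>{m..<2 * m}. (1 / y) powr a * exp (- 6))"
    by simp
  also have "\<dots> \<le> (\<Sum>n\<in>{m..<2 * m}. (1 + real n) powr a * x ^ n)"
    by (rule sum_mono[OF block])
  also have "\<dots> \<le> (\<Sum>n. (1 + real n) powr a * x ^ n)"
    using a x by (intro sum_le_suminf powr_geometric_series_upper(1)) auto
  finally show ?thesis by (simp add: y_def)
qed

text \<open>The weight \<open>2 + k\<close> arises because the coefficient \<open>c * p ^ k\<close>
  of the ansatz sits at index \<open>k + 1\<close>. It exceeds \<open>1 + k\<close> by a factor of
  at most 2.\<close>

lemma powr_geometric_series_shift:
  assumes a: "a > 0" and x: "0 \<le> x" "x < 1"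
  shows "summable (\<lambda>k. (2 + real k) powr a * x ^ k)" (is ?S)
    and "(\<Sum>k. (2 + real k) powr a * x ^ k) \<le> 2 powr a * (6 * (2 * a) powr a) * (1 - x) powr - (a + 1)" (is ?U)
    and "1 / 2 \<le> x \<Longrightarrow> exp (- 6) * (1 - x) powr - (a + 1) \<le> (\<Sum>k. (2 + real k) powr a * x ^ k)" (is "_ \<Longrightarrow> ?L")
proof -
  note U = powr_geometric_series_upper[OF a x]
  have le: "(2 + real k) powr a * x ^ k \<le> 2 powr a * ((1 + real k) powr a * x ^ k)" for k
  proof -
    have "(2 + real k) powr a \<le> (2 * (1 + real k)) powr a"
      using a by (intro powr_mono2) auto
    also have "\<dots> = 2 powr a * (1 + real k) powr a"
      by (rule powr_mult)
    finally have "(2 + real k) powr a * x ^ k \<le> 2 powr a * (1 + real k) powr a * x ^ k"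
      using x by (intro mult_right_mono) auto
    then show ?thesis by (simp only: mult.assoc)
  qed
  show S: ?S
    by (rule summable_comparison_test'[OF summable_mult[OF U(1)], of 0]) (use x le in simp)
  have "(\<Sum>k. (2 + real k) powr a * x ^ k) \<le> 2 powr a * (\<Sum>k. (1 + real k) powr a * x ^ k)"
    unfolding suminf_mult[OF U(1), symmetric] by (rule suminf_le[OF le S summable_mult[OF U(1)]])
  also have "\<dots> \<le> 2 powr a * (6 * (2 * a) powr a * (1 - x) powr - (a + 1))"
    by (intro mult_left_mono U(2)) auto
  finally show ?U by (simp only: mult.assoc)
  assume "1 / 2 \<le> x"
  then have "exp (- 6) * (1 - x) powr - (a + 1) \<le> (\<Sum>k. (1 + real k) powr a * x ^ k)"
    using a x by (intro powr_geometric_series_lower) auto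
  also have "\<dots> \<le> (\<Sum>k. (2 + real k) powr a * x ^ k)"
    using a x by (intro suminf_le S U(1) mult_right_mono powr_mono2) auto
  finally show ?L .
qed

section \<open>The family of rational functions\<close>

definition mobius_seq :: "complex \<Rightarrow> complex \<Rightarrow> complex \<Rightarrow> hardy" where
  "mobius_seq b c p = (\<lambda>n. case n of 0 \<Rightarrow> b | Suc k \<Rightarrow> c * p ^ k)"

lemma mobius_seq_simps [simp]:
  "mobius_seq b c p 0 = b" "mobius_seq b c p (Suc k) = c * p ^ k"
  by (simp_all add: mobius_seq_def)

lemma mobius_seq_sums:
  assumes "cmod (p * z) < 1"
  shows "(\<lambda>n. mobius_seq b c p n * z ^ n) sums (b + c * z / (1 - p * z))"
proof -
  have "(\<lambda>k. c * z * (p * z) ^ k) sums (c * z * (1 / (1 - p * z)))"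
    by (intro sums_mult geometric_sums assms)
  then have "(\<lambda>k. mobius_seq b c p (Suc k) * z ^ Suc k) sums (c * z / (1 - p * z))"
    by (simp add: power_mult_distrib mult_ac)
  then show ?thesis
    by (subst (asm) sums_Suc_iff) (simp add: add.commute)
qed

lemma mobius_seq_in_rational_L1:
  assumes p: "cmod p < 1" and c: "c \<noteq> 0"
  shows "mobius_seq b c p \<in> rational_L1"
proof -
  let ?A = "[:b, c - b * p:]" and ?B = "[:1, - p:]"
  have pz: "cmod (p * z) < 1" if "cmod z \<le> 1" for z
    using mult_mono[OF order_refl that, of "cmod p"] p by (simp add: norm_mult)
  \<comment> \<open>Bezout coefficients: \<open>A = b B + c z\<close> and
    \<open>p z = 1 - B\<close>, so \<open>(p / c) A = (p b / c) B + 1 - B\<close>.\<close>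
  have "[:p / c:] * ?A + [:1 - p * b / c:] * ?B = 1"
    using c by (simp add: field_simps one_pCons)
  then have "coprime ?A ?B"
    by (metis coprimeI dvd_add dvd_mult)
  \<comment> \<open>For \<open>p = 0\<close> the denominator is constant and
    \<open>c \<noteq> 0\<close> gives the numerator degree 1. The orbit below meets this case at
    time 0 when \<open>\<beta> = 16\<close>.\<close>
  moreover have "degree ?A = 1 \<or> degree ?B = 1"
    using c by auto
  moreover have nz: "1 - p * z \<noteq> 0" if "cmod z \<le> 1" for z
    using pz[OF that] by auto
  moreover have "(\<lambda>n. mobius_seq b c p n * z ^ n) sums (poly ?A z / poly ?B z)" if "cmod z \<le> 1" for z
  proof -
    have "b + c * z / (1 - p * z) = poly ?A z / poly ?B z"
      using nz[OF that] by (simp add: field_simps)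
    then show ?thesis
      using mobius_seq_sums[OF pz[OF that], of b c] by simp
  qed
  ultimately have "degree ?A \<le> 1 \<and> degree ?B \<le> 1 \<and> coprime ?A ?B \<and> (degree ?A = 1 \<or> degree ?B = 1) \<and>
     (\<forall>z. cmod z \<le> 1 \<longrightarrow> poly ?B z \<noteq> 0) \<and>
     (\<forall>z. cmod z \<le> 1 \<longrightarrow> (\<lambda>n. mobius_seq b c p n * z ^ n) sums (poly ?A z / poly ?B z))"
    by (simp add: mult.commute)
  then show ?thesis
    unfolding rational_L1_def by blast
qed

lemma mobius_seq_sobolev:
  assumes p: "cmod p < 1" and s: "s > 0"
  shows "mobius_seq b c p \<in> sobolev_plus s"
    and "(sobolev_norm s (mobius_seq b c p))\<^sup>2 =
      (cmod b)\<^sup>2 + (cmod c)\<^sup>2 * (\<Sum>k. (2 + real k) powr (2 * s) * ((cmod p)\<^sup>2) ^ k)"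
proof -
  let ?g = "\<lambda>k. (2 + real k) powr (2 * s) * ((cmod p)\<^sup>2) ^ k"
  have g: "summable ?g"
    using p s by (intro powr_geometric_series_shift(1)) (auto simp: abs_square_less_1)
  have "(\<lambda>k. (cmod c)\<^sup>2 * ?g k) sums ((cmod c)\<^sup>2 * suminf ?g)"
    by (intro sums_mult summable_sums g)
  moreover have "(cmod c)\<^sup>2 * ?g k = (1 + real (Suc k)) powr (2 * s) * (cmod (mobius_seq b c p (Suc k)))\<^sup>2" for k
    by (simp add: norm_mult norm_power power_mult_distrib mult_ac flip: power_mult)
  ultimately have "(\<lambda>k. (1 + real (Suc k)) powr (2 * s) * (cmod (mobius_seq b c p (Suc k)))\<^sup>2) sums ((cmod c)\<^sup>2 * suminf ?g)"
    by simp
  then have S: "(\<lambda>n. (1 + real n) powr (2 * s) * (cmod (mobius_seq b c p n))\<^sup>2) sums ((cmod b)\<^sup>2 + (cmod c)\<^sup>2 * suminf ?g)"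
    by (subst (asm) sums_Suc_iff) (simp add: add.commute)
  show in_s: "mobius_seq b c p \<in> sobolev_plus s"
    using sums_summable[OF S] by (simp add: sobolev_plus_def)
  show "(sobolev_norm s (mobius_seq b c p))\<^sup>2 = (cmod b)\<^sup>2 + (cmod c)\<^sup>2 * suminf ?g"
    by (rule sums_unique2[OF sobolev_norm_sums[OF in_s] S])
qed

section \<open>The vector field on rational functions\<close>

lemma cmod_mult_cis_less_1: "cmod p < 1 \<Longrightarrow> cmod (p * cis \<theta>) < 1"
  by (simp add: norm_mult)

lemma one_minus_mult_cnj_nonzero:
  assumes "cmod p < 1"
  shows "1 - p * cnj p \<noteq> 0"
proof
  assume "1 - p * cnj p = 0"
  then have "cmod (p * cnj p) = 1" by (metis eq_iff_diff_eq_0 norm_one)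
  then show False
    using assms mult_strict_mono[of "cmod p" 1 "cmod p" 1] by (simp add: norm_mult)
qed

lemma geometric_abs_summable:
  assumes "cmod p < 1"
  shows "summable (\<lambda>k. cmod (A * p ^ k))"
    "summable (\<lambda>k. cmod (A * of_nat (Suc k) * p ^ k))"
proof -
  show "summable (\<lambda>k. cmod (A * p ^ k))"
    using assms by (simp add: norm_mult norm_power summable_mult summable_geometric)
  have "summable (\<lambda>k. real (Suc k) * cmod p ^ k)"
    using geometric_deriv_sums[of "cmod p"] assms by (auto dest: sums_summable)
  then have "summable (\<lambda>k. cmod A * (real (Suc k) * cmod p ^ k))"
    by (rule summable_mult)
  then show "summable (\<lambda>k. cmod (A * of_nat (Suc k) * p ^ k))"
    by (simp only: norm_mult norm_power norm_of_nat mult.assoc)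
qed

text \<open>After division by \<open>cis \<theta>\<close>, the geometric series in
  \<open>p * cis (- \<theta>)\<close> contains the frequencies -1, -2, ... only. It is applied below
  to the conjugate of the parameter of the ansatz.\<close>

lemma szego_projector_antianalytic:
  assumes "cmod p < 1"
  shows "szego_projector (\<lambda>\<theta>. 1 / (cis \<theta> - p)) n = 0"
    and "continuous_on UNIV (\<lambda>\<theta>. 1 / (cis \<theta> - p))"
proof -
  have nz: "cis \<theta> - p \<noteq> 0" for \<theta>
    using assms by auto
  show "continuous_on UNIV (\<lambda>\<theta>. 1 / (cis \<theta> - p))"
    using nz by (auto intro!: continuous_intros)
  have "(\<lambda>k. p ^ k * cis (of_int (- int (Suc k)) * \<theta>)) sums (1 / (cis \<theta> - p))" for \<theta>
  proof -
    have "cmod (p * cis (- \<theta>)) < 1"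
      using assms by (rule cmod_mult_cis_less_1)
    then have "(\<lambda>k. cis (- \<theta>) * (p * cis (- \<theta>)) ^ k) sums (cis (- \<theta>) * (1 / (1 - p * cis (- \<theta>))))"
      by (intro sums_mult geometric_sums)
    moreover have "cis (- \<theta>) * (p * cis (- \<theta>)) ^ k = p ^ k * cis (of_int (- int (Suc k)) * \<theta>)" for k
      by (simp add: power_mult_distrib Complex.DeMoivre cis_mult algebra_simps)
    moreover have "cis (- \<theta>) * (1 / (1 - p * cis (- \<theta>))) = 1 / (cis \<theta> - p)"
    proof -
      have "cis \<theta> * (1 - p * cis (- \<theta>)) = cis \<theta> - p"
        by (simp add: algebra_simps cis_mult)
      then show ?thesis
        using nz[of \<theta>] cis_neq_zero[of \<theta>] by (metis cis_inverse divide_inverse inverse_mult_distrib mult_1 mult.commute)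
    qed
    ultimately show ?thesis by simp
  qed
  then have eq: "(\<lambda>\<theta>. 1 / (cis \<theta> - p)) = (\<lambda>\<theta>. \<Sum>k. p ^ k * cis (of_int (- int (Suc k)) * \<theta>))"
    by (auto simp: sums_iff)
  have "summable (\<lambda>k. cmod (p ^ k))"
    using geometric_abs_summable(1)[OF assms, of 1] by simp
  from fourier_coeff_series[OF this, of "\<lambda>k. - int (Suc k)" "int n"]
  have "(\<lambda>k. 0) sums fourier_coeff (\<lambda>\<theta>. 1 / (cis \<theta> - p)) (int n)"
    unfolding eq by (simp add: if_distrib cong: if_cong)
  then show "szego_projector (\<lambda>\<theta>. 1 / (cis \<theta> - p)) n = 0"
    by (simp add: szego_projector_def sums_iff)
qed

lemma szego_projector_circle_fun_plus:
  assumes "summable (\<lambda>n. cmod (\<gamma> n))" "cmod p < 1"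
  shows "szego_projector (\<lambda>\<theta>. circle_fun \<gamma> \<theta> + \<kappa> * (1 / (cis \<theta> - p))) n = \<gamma> n"
proof -
  note anti = szego_projector_antianalytic[OF assms(2)]
  have "continuous_on UNIV (\<lambda>\<theta>. \<kappa> * (1 / (cis \<theta> - p)))"
    by (intro continuous_on_mult_left anti)
  from fourier_coeff_add[OF continuous_circle_fun[OF assms(1)] this] show ?thesis
    unfolding szego_projector_def fourier_coeff_cmult
    by (simp only: anti(1)[unfolded szego_projector_def] fourier_coeff_circle_fun[OF assms(1)] mult_zero_right add_0_right)
qed

lemma circle_fun_mobius_seq:
  assumes "cmod p < 1"
  shows "circle_fun (mobius_seq b c p) \<theta> = b + c * cis \<theta> / (1 - p * cis \<theta>)"
  using mobius_seq_sums[OF cmod_mult_cis_less_1[OF assms], of b c]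
  by (simp add: circle_fun_def Complex.DeMoivre sums_iff)

text \<open>
  With \<open>G = 1/(1 - p\<zeta>)\<close>, \<open>W = 1/(\<zeta> - q)\<close> (where \<open>q\<close> is the conjugate of \<open>p\<close>) and \<open>Y = 1/(1 - pq)\<close>, the
  partial fraction rule is \<open>\<zeta>GW = Y(G + qW)\<close>.
\<close>

lemma partial_fractions:
  fixes e p q :: complex
  assumes "G * (1 - p * e) = 1" "W * (e - q) = 1" "Y * (1 - p * q) = 1"
  shows "e * G * W = Y * (G + q * W)" "G = 1 + p * e * G"
proof -
  have "e * G * W = (Y * (1 - p * q)) * (e * G * W)"
    by (simp only: assms mult_1)
  also have "\<dots> = Y * (G * (W * (e - q)) + q * W * (G * (1 - p * e)))"
    by (simp add: algebra_simps)
  finally show "e * G * W = Y * (G + q * W)"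
    by (simp only: assms mult_1_right)
  show "G = 1 + p * e * G"
    using assms(1) by (simp add: algebra_simps)
qed

text \<open>On the circle the conjugate of \<open>e * G\<close> is \<open>W\<close>, so the cubic
  term is \<open>(b + c e G)^2 (cnj b + cnj c W)\<close>. Applying the partial fraction rule twice
  splits it into an analytic part with Taylor coefficients \<open>\<gamma>\<close> and a multiple of
  \<open>W\<close>, which the projector annihilates. At \<open>k = 0\<close> the summand with
  \<open>p ^ (k - 1)\<close> vanishes through its factor \<open>of_nat k\<close>.\<close>

lemma szego_cubic_mobius_seq:
  fixes b c p :: complex
  assumes p: "cmod p < 1"
  defines "Y \<equiv> 1 / (1 - p * cnj p)"
  shows "szego_projector (cubic (circle_fun (mobius_seq b c p))) n =
    (case n of 0 \<Rightarrow> cnj b * b\<^sup>2 + 2 * b * c * cnj c * Y + c\<^sup>2 * cnj c * cnj p * Y\<^sup>2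
     | Suc k \<Rightarrow> (2 * b * cnj b * c + 2 * b * c * cnj c * p * Y + c\<^sup>2 * cnj c * p * cnj p * Y\<^sup>2) * p ^ k
        + cnj b * c\<^sup>2 * (of_nat k * p ^ (k - 1)) + c\<^sup>2 * cnj c * Y * (of_nat (Suc k) * p ^ k))"
proof -
  define \<gamma>\<^sub>0 where "\<gamma>\<^sub>0 = cnj b * b\<^sup>2 + 2 * b * c * cnj c * Y + c\<^sup>2 * cnj c * cnj p * Y\<^sup>2"
  define A where "A = 2 * b * cnj b * c + 2 * b * c * cnj c * p * Y + c\<^sup>2 * cnj c * p * cnj p * Y\<^sup>2"
  define B where "B = cnj b * c\<^sup>2"
  define C where "C = c\<^sup>2 * cnj c * Y"
  \<comment> \<open>This is the residue at \<open>z = cnj p\<close>: \<open>cnj c\<close> times the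
    square of the value of \<open>b + c z / (1 - p z)\<close> there.\<close>
  define \<kappa> where "\<kappa> = cnj c * (b + c * cnj p * Y)\<^sup>2"
  define \<delta> where "\<delta> k = A * p ^ k + B * (of_nat k * p ^ (k - 1)) + C * (of_nat (Suc k) * p ^ k)" for k
  define \<gamma> where "\<gamma> = (\<lambda>n. case n of 0 \<Rightarrow> \<gamma>\<^sub>0 | Suc k \<Rightarrow> \<delta> k)"
  have "summable (\<lambda>k. cmod (B * (of_nat (Suc k) * p ^ k)))"
    using geometric_abs_summable(2)[OF p, of B] by (simp only: mult.assoc)
  then have B_sum: "summable (\<lambda>k. cmod (B * (of_nat k * p ^ (k - 1))))"
    by (subst summable_Suc_iff[symmetric]) simp
  have "summable (\<lambda>k. cmod (A * p ^ k) + cmod (B * (of_nat k * p ^ (k - 1))) + cmod (C * (of_nat (Suc k) * p ^ k)))"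
    using geometric_abs_summable(1)[OF p, of A] geometric_abs_summable(2)[OF p, of C]
    by (intro summable_add B_sum) (simp_all only: mult.assoc)
  then have "summable (\<lambda>k. cmod (\<delta> k))"
    by (rule summable_comparison_test'[where N = 0])
       (simp only: \<delta>_def real_norm_def abs_norm_cancel, rule order_trans[OF norm_triangle_ineq add_right_mono[OF norm_triangle_ineq]])
  then have \<gamma>: "summable (\<lambda>n. cmod (\<gamma> n))"
    by (subst summable_Suc_iff[symmetric]) (simp add: \<gamma>_def)
  have pp: "1 - p * cnj p \<noteq> 0"
    by (rule one_minus_mult_cnj_nonzero[OF p])
  have "cubic (circle_fun (mobius_seq b c p)) \<theta> = circle_fun \<gamma> \<theta> + \<kappa> * (1 / (cis \<theta> - cnj p))" for \<theta>
  proof -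
    define e where "e = cis \<theta>"
    define G where "G = 1 / (1 - p * e)"
    define W where "W = 1 / (e - cnj p)"
    have pe: "cmod (p * e) < 1"
      unfolding e_def by (rule cmod_mult_cis_less_1[OF p])
    have "e - cnj p \<noteq> 0"
      using p by (auto simp: e_def dest!: arg_cong[where f = cmod])
    moreover have "1 - p * e \<noteq> 0"
      using pe by auto
    ultimately have nz: "G * (1 - p * e) = 1" "W * (e - cnj p) = 1" "Y * (1 - p * cnj p) = 1"
      using pp by (simp_all add: G_def W_def Y_def)
    note pf = partial_fractions[OF nz]
    have u: "circle_fun (mobius_seq b c p) \<theta> = b + c * (e * G)"
      by (simp add: circle_fun_mobius_seq[OF p] e_def G_def)
    have "cnj (e * G) = W"
    proof -
      have "cnj e * (e - cnj p) = 1 - cnj (p * e)"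
        by (simp add: e_def algebra_simps cis_cnj cis_mult)
      then have "cnj (e * G) * (e - cnj p) = cnj (G * (1 - p * e))"
        by (simp add: mult_ac)
      then have "cnj (e * G) * (e - cnj p) = W * (e - cnj p)"
        unfolding nz by simp
      then show ?thesis
        using \<open>e - cnj p \<noteq> 0\<close> by simp
    qed
    then have cu: "cnj (b + c * (e * G)) = cnj b + cnj c * W"
      by simp
    have "cubic (circle_fun (mobius_seq b c p)) \<theta> = (b + c * (e * G))\<^sup>2 * (cnj b + cnj c * W)"
      unfolding cubic_def u complex_norm_square cu by (simp add: power2_eq_square mult_ac)
    also have "\<dots> = cnj b * b\<^sup>2 + 2 * b * cnj b * c * (e * G) + cnj b * c\<^sup>2 * (e * (e * G\<^sup>2))
        + cnj c * b\<^sup>2 * W + 2 * b * c * cnj c * (e * G * W) + c\<^sup>2 * cnj c * (e * G * (e * G * W))"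
      by (simp add: power2_eq_square algebra_simps)
    also have "e * G * W = Y * (1 + p * (e * G) + cnj p * W)"
      unfolding pf(1) by (subst pf(2)) (simp add: mult_ac)
    also have "e * G * (Y * (1 + p * (e * G) + cnj p * W)) = Y * (e * G\<^sup>2) + Y * cnj p * (Y * (1 + p * (e * G) + cnj p * W))"
    proof -
      have "e * G * (Y * (1 + p * (e * G) + cnj p * W)) = Y * (e * G * (1 + p * e * G)) + Y * cnj p * (e * G * W)"
        by (simp add: algebra_simps)
      also have "\<dots> = Y * (e * G\<^sup>2) + Y * cnj p * (Y * (1 + p * e * G + cnj p * W))"
        unfolding pf(2)[symmetric] unfolding pf(1) by (simp add: power2_eq_square mult_ac)
      finally show ?thesis by (simp add: mult_ac)
    qed
    finally have 1: "cubic (circle_fun (mobius_seq b c p)) \<theta> =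
        \<gamma>\<^sub>0 + (A * G + B * (e * G\<^sup>2) + C * G\<^sup>2) * e + \<kappa> * W"
      by (simp add: \<gamma>\<^sub>0_def A_def B_def C_def \<kappa>_def power2_eq_square algebra_simps)
    have s1: "(\<lambda>k. (p * e) ^ k) sums G"
      unfolding G_def by (rule geometric_sums[OF pe])
    have s2: "(\<lambda>k. of_nat (Suc k) * (p * e) ^ k) sums G\<^sup>2"
      using geometric_deriv_sums[OF pe] by (simp add: G_def power_one_over)
    have "(\<lambda>k. of_nat (Suc k) * p ^ (Suc k - 1) * e ^ Suc k) sums (e * G\<^sup>2)"
      using sums_mult[OF s2, of e] by (simp add: power_mult_distrib mult_ac)
    then have s3: "(\<lambda>k. of_nat k * p ^ (k - 1) * e ^ k) sums (e * G\<^sup>2)"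
      by (subst (asm) sums_Suc_iff) simp
    have "(\<lambda>k. (A * (p * e) ^ k + B * (of_nat k * p ^ (k - 1) * e ^ k) + C * (of_nat (Suc k) * (p * e) ^ k)) * e)
        sums ((A * G + B * (e * G\<^sup>2) + C * G\<^sup>2) * e)"
      by (intro sums_mult2 sums_add sums_mult s1 s2 s3)
    moreover have "(A * (p * e) ^ k + B * (of_nat k * p ^ (k - 1) * e ^ k) + C * (of_nat (Suc k) * (p * e) ^ k)) * e = \<gamma> (Suc k) * e ^ Suc k" for k
      by (simp add: \<gamma>_def \<delta>_def power_mult_distrib algebra_simps)
    ultimately have "(\<lambda>k. \<gamma> (Suc k) * e ^ Suc k) sums ((A * G + B * (e * G\<^sup>2) + C * G\<^sup>2) * e)"
      by (simp only:)
    then have "(\<lambda>n. \<gamma> n * e ^ n) sums ((A * G + B * (e * G\<^sup>2) + C * G\<^sup>2) * e + \<gamma>\<^sub>0)"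
      by (subst (asm) sums_Suc_iff) (simp add: \<gamma>_def)
    then have "circle_fun \<gamma> \<theta> = \<gamma>\<^sub>0 + (A * G + B * (e * G\<^sup>2) + C * G\<^sup>2) * e"
      by (simp add: circle_fun_def e_def Complex.DeMoivre sums_iff add.commute)
    then show ?thesis
      unfolding 1 by (simp add: W_def e_def)
  qed
  then have "cubic (circle_fun (mobius_seq b c p)) = (\<lambda>\<theta>. circle_fun \<gamma> \<theta> + \<kappa> * (1 / (cis \<theta> - cnj p)))"
    by auto
  then have "szego_projector (cubic (circle_fun (mobius_seq b c p))) n = \<gamma> n"
    using szego_projector_circle_fun_plus[OF \<gamma>, of "cnj p"] p by simp
  then show ?thesis
    unfolding \<gamma>_def \<gamma>\<^sub>0_def A_def B_def C_def \<delta>_def .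
qed

lemma shift_adj_mobius_seq: "shift_adj (mobius_seq b c p) = mobius_seq c (c * p) p"
proof
  fix n
  show "shift_adj (mobius_seq b c p) n = mobius_seq c (c * p) p n"
    by (cases n) (simp_all add: shift_adj_def)
qed

text \<open>The sequence is \<open>c * p ^ n\<close>, the image of the ansatz under
  \<open>shift_adj\<close>. For it the general formula collapses by
  \<open>Y = 1 + |p|^2 Y\<close>.\<close>

lemma szego_cubic_geometric:
  fixes c p :: complex
  assumes p: "cmod p < 1"
  defines "Y \<equiv> 1 / (1 - p * cnj p)"
  shows "szego_projector (cubic (circle_fun (mobius_seq c (c * p) p))) n =
    c\<^sup>2 * cnj c * Y * (of_nat n * p ^ n + Y * p ^ n)"
proof -
  have "1 - p * cnj p \<noteq> 0"
    by (rule one_minus_mult_cnj_nonzero[OF p])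
  then have Y: "Y = 1 + p * cnj p * Y"
    by (simp add: Y_def field_simps)
  show ?thesis
  proof (cases n)
    case 0
    have "cnj c * c\<^sup>2 + 2 * c * (c * p) * cnj (c * p) * Y + (c * p)\<^sup>2 * cnj (c * p) * cnj p * Y\<^sup>2 =
        c\<^sup>2 * cnj c * (1 + p * cnj p * Y)\<^sup>2"
      by (simp add: power2_eq_square algebra_simps)
    also have "\<dots> = c\<^sup>2 * cnj c * Y * Y"
      unfolding Y[symmetric] by (simp add: power2_eq_square)
    finally show ?thesis
      unfolding szego_cubic_mobius_seq[OF p, folded Y_def] 0 by simp
  next
    case (Suc k)
    have k: "of_nat k * p ^ (k - 1) * p = of_nat k * p ^ k"
      by (cases k) auto
    have "(2 * c * cnj c * (c * p) + 2 * c * (c * p) * cnj (c * p) * p * Y + (c * p)\<^sup>2 * cnj (c * p) * p * cnj p * Y\<^sup>2) * p ^ k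
        + cnj c * (c * p)\<^sup>2 * (of_nat k * p ^ (k - 1)) + (c * p)\<^sup>2 * cnj (c * p) * Y * (of_nat (Suc k) * p ^ k) =
       c\<^sup>2 * cnj c * p * p ^ k * (2 * (1 + p * cnj p * Y) + p * cnj p * Y * (p * cnj p * Y) + p * cnj p * Y * of_nat (Suc k))
        + c\<^sup>2 * cnj c * p * (of_nat k * p ^ (k - 1) * p)"
      by (simp add: power2_eq_square algebra_simps)
    also have "\<dots> = c\<^sup>2 * cnj c * p * p ^ k * (2 * Y + (Y - 1) * (Y - 1) + (Y - 1) * of_nat (Suc k) + of_nat k)"
    proof -
      have Y1: "p * cnj p * Y = Y - 1" using Y by (metis add_diff_cancel_left')
      show ?thesis
        unfolding k Y1 by (simp add: algebra_simps)
    qed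
    also have "\<dots> = c\<^sup>2 * cnj c * Y * (of_nat (Suc k) * p ^ Suc k + Y * p ^ Suc k)"
      by (simp add: power2_eq_square algebra_simps)
    finally show ?thesis
      unfolding szego_cubic_mobius_seq[OF p, folded Y_def] Suc nat.case .
  qed
qed

text \<open>The grouping shows that the vector field is tangent to the family: varying
  \<open>c\<close> moves the coefficients along \<open>p ^ k\<close> and varying \<open>p\<close>
  along \<open>c * k * p ^ (k - 1)\<close>, so the factors of these two expressions are the values
  that the equation prescribes for \<open>i c'\<close> and \<open>i p'\<close>.\<close>

lemma beta_szego_rhs_mobius_seq:
  fixes b c p :: complex and \<beta> :: real
  assumes p: "cmod p < 1"
  defines "Y \<equiv> 1 / (1 - p * cnj p)"
  shows "beta_szego_rhs \<beta> (mobius_seq b c p) n =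
    (case n of 0 \<Rightarrow> cnj b * b\<^sup>2 + 2 * b * c * cnj c * Y + c\<^sup>2 * cnj c * cnj p * Y\<^sup>2
     | Suc k \<Rightarrow> (2 * b * cnj b * c + 2 * b * c * cnj c * p * Y + (1 - of_real \<beta>) * c\<^sup>2 * cnj c * Y\<^sup>2) * p ^ k
        + c * (of_nat k * p ^ (k - 1)) * (cnj b * c + (1 - of_real \<beta>) * c * cnj c * p * Y))"
proof (cases n)
  case 0
  then show ?thesis
    by (simp add: beta_szego_rhs_def shift_def szego_cubic_mobius_seq[OF p, folded Y_def])
next
  case (Suc k)
  have "1 - p * cnj p \<noteq> 0"
    by (rule one_minus_mult_cnj_nonzero[OF p])
  then have Y1: "p * cnj p * Y = Y - 1"
    by (simp add: Y_def field_simps)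
  have k: "of_nat k * p ^ (k - 1) * p = of_nat k * p ^ k"
    by (cases k) auto
  have "beta_szego_rhs \<beta> (mobius_seq b c p) n = (2 * b * cnj b * c + 2 * b * c * cnj c * p * Y + c\<^sup>2 * cnj c * p * cnj p * Y\<^sup>2) * p ^ k
        + cnj b * c\<^sup>2 * (of_nat k * p ^ (k - 1)) + c\<^sup>2 * cnj c * Y * (of_nat (Suc k) * p ^ k)
        - of_real \<beta> * (c\<^sup>2 * cnj c * Y * (of_nat k * p ^ k + Y * p ^ k))"
    unfolding Suc beta_szego_rhs_def shift_adj_mobius_seq shift_def nat.case szego_cubic_geometric[OF p, folded Y_def]
      szego_cubic_mobius_seq[OF p, of b c "Suc k", folded Y_def] ..
  also have "c\<^sup>2 * cnj c * p * cnj p * Y\<^sup>2 = c\<^sup>2 * cnj c * Y * (p * cnj p * Y)"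
    by (simp add: power2_eq_square mult_ac)
  also have "(2 * b * cnj b * c + 2 * b * c * cnj c * p * Y + c\<^sup>2 * cnj c * Y * (p * cnj p * Y)) * p ^ k
        + cnj b * c\<^sup>2 * (of_nat k * p ^ (k - 1)) + c\<^sup>2 * cnj c * Y * (of_nat (Suc k) * p ^ k)
        - of_real \<beta> * (c\<^sup>2 * cnj c * Y * (of_nat k * p ^ k + Y * p ^ k)) =
      (2 * b * cnj b * c + 2 * b * c * cnj c * p * Y + (1 - of_real \<beta>) * c\<^sup>2 * cnj c * Y\<^sup>2) * p ^ k
        + c * (of_nat k * p ^ (k - 1)) * (cnj b * c)
        + (1 - of_real \<beta>) * c\<^sup>2 * cnj c * Y * (of_nat k * p ^ k)"
    unfolding Y1 by (simp add: power2_eq_square algebra_simps)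
  also have "\<dots> = (2 * b * cnj b * c + 2 * b * c * cnj c * p * Y + (1 - of_real \<beta>) * c\<^sup>2 * cnj c * Y\<^sup>2) * p ^ k
        + c * (of_nat k * p ^ (k - 1)) * (cnj b * c + (1 - of_real \<beta>) * c * cnj c * p * Y)"
    unfolding k[symmetric] by (simp add: power2_eq_square algebra_simps)
  finally show ?thesis unfolding Suc by simp
qed

section \<open>Differentiability in the Sobolev norm\<close>

lemma has_vector_derivative_quotient:
  fixes f :: "real \<Rightarrow> complex"
  assumes "(f has_vector_derivative f') (at t)"
  shows "((\<lambda>h. (f (t + h) - f t) / of_real h) \<longlongrightarrow> f') (at 0)"
proof -
  have "((\<lambda>h. norm (f (t + h) - f t - h *\<^sub>R f') / norm h) \<longlongrightarrow> 0) (at 0)"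
    using assms unfolding has_vector_derivative_def has_derivative_at by simp
  moreover have "\<forall>\<^sub>F h in at 0. norm (f (t + h) - f t - h *\<^sub>R f') / norm h = norm ((f (t + h) - f t) / of_real h - f')"
  proof -
    have "norm (f (t + h) - f t - h *\<^sub>R f') / norm h = norm ((f (t + h) - f t) / of_real h - f')" if "h \<noteq> 0" for h
    proof -
      have "(f (t + h) - f t) / of_real h - f' = (f (t + h) - f t - h *\<^sub>R f') / of_real h"
        using that by (simp add: field_simps scaleR_conv_of_real)
      then show ?thesis by (simp add: norm_divide)
    qed
    then show ?thesis by (auto simp: eventually_at_filter)
  qed
  ultimately have "((\<lambda>h. norm ((f (t + h) - f t) / of_real h - f')) \<longlongrightarrow> 0) (at 0)"
    by (rule Lim_transform_eventually)
  then show ?thesis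
    by (rule LIM_zero_cancel[OF tendsto_norm_zero_cancel])
qed

lemma norm_power_diff_le:
  fixes z w :: complex
  assumes "norm z \<le> \<rho>" "norm w \<le> \<rho>"
  shows "norm (z ^ k - w ^ k) \<le> real k * \<rho> ^ (k - 1) * norm (z - w)"
proof (induction k)
  case (Suc k)
  have \<rho>: "0 \<le> \<rho>" using assms(1) norm_ge_zero order_trans by blast
  have "z ^ Suc k - w ^ Suc k = z * (z ^ k - w ^ k) + (z - w) * w ^ k"
    by (simp add: algebra_simps)
  then have "norm (z ^ Suc k - w ^ Suc k) \<le> norm z * norm (z ^ k - w ^ k) + norm (z - w) * norm w ^ k"
    by (metis norm_mult norm_power norm_triangle_ineq)
  also have "\<dots> \<le> \<rho> * (real k * \<rho> ^ (k - 1) * norm (z - w)) + norm (z - w) * \<rho> ^ k"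
    using assms \<rho> Suc by (intro add_mono mult_mono power_mono) auto
  also have "\<dots> = real (Suc k) * \<rho> ^ (Suc k - 1) * norm (z - w)"
    by (cases k) (simp_all add: algebra_simps)
  finally show ?case .
qed simp

definition mobius_seq_deriv :: "complex \<Rightarrow> complex \<Rightarrow> complex \<Rightarrow> complex \<Rightarrow> complex \<Rightarrow> hardy" where
  "mobius_seq_deriv b' c p c' p' =
     (\<lambda>n. case n of 0 \<Rightarrow> b' | Suc k \<Rightarrow> c' * p ^ k + c * (of_nat k * p ^ (k - 1) * p'))"

lemma mobius_seq_has_vector_derivative:
  assumes "(b has_vector_derivative b') (at t)" "(c has_vector_derivative c') (at t)"
    "(p has_vector_derivative p') (at t)"
  shows "((\<lambda>t. mobius_seq (b t) (c t) (p t) n) has_vector_derivative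
    mobius_seq_deriv b' (c t) (p t) c' p' n) (at t)"
proof (cases n)
  case 0
  then show ?thesis using assms by (simp add: mobius_seq_deriv_def)
next
  case (Suc k)
  have "((\<lambda>z. z ^ k) has_field_derivative of_nat k * p t ^ (k - 1)) (at (p t))"
    by (auto intro!: derivative_eq_intros)
  from field_vector_diff_chain_at[OF assms(3) this]
  have "((\<lambda>t. p t ^ k) has_vector_derivative of_nat k * p t ^ (k - 1) * p') (at t)"
    by (simp add: o_def mult.commute)
  from has_vector_derivative_mult[OF assms(2) this] show ?thesis
    by (simp add: Suc mobius_seq_deriv_def add.commute mult.commute)
qed

text \<open>One majorant \<open>L (1 + n) \<rho> ^ n\<close> is to dominate the derivative and all
  nearby difference quotients. The divisions by \<open>\<rho>\<close> inside \<open>L\<close> pay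
  for raising the powers \<open>k - 1\<close> and \<open>k\<close> to \<open>Suc k\<close>; the
  first claim handles index 0.\<close>

lemma power_majorant:
  fixes K \<rho> :: real
  assumes \<rho>: "0 < \<rho>" "\<rho> < 1" and K: "0 \<le> K"
  defines "L \<equiv> (K + K * K / \<rho>) / \<rho>"
  shows "K \<le> L" and "K * \<rho> ^ k + K * (real k * \<rho> ^ (k - 1) * K) \<le> L * ((1 + real (Suc k)) * \<rho> ^ Suc k)"
proof -
  have "K * \<rho> \<le> K" "0 \<le> K * K / \<rho>"
    using \<rho> K by (auto intro: mult_left_le)
  then have "K * \<rho> \<le> K + K * K / \<rho>" by linarith
  then show "K \<le> L"
    unfolding L_def using \<rho>(1) by (subst le_divide_eq) auto
  have pk: "real k * \<rho> ^ (k - 1) = real k * \<rho> ^ k / \<rho>"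
    using \<rho> by (cases k) auto
  have "K * \<rho> ^ k + K * (real k * \<rho> ^ (k - 1) * K) = K * \<rho> ^ k + K * K / \<rho> * (real k * \<rho> ^ k)"
    unfolding pk by simp
  also have "\<dots> \<le> K * ((1 + real (Suc k)) * \<rho> ^ k) + K * K / \<rho> * ((1 + real (Suc k)) * \<rho> ^ k)"
  proof (intro add_mono mult_left_mono)
    show "\<rho> ^ k \<le> (1 + real (Suc k)) * \<rho> ^ k"
      using \<rho> by (simp add: mult_le_cancel_right1)
    show "real k * \<rho> ^ k \<le> (1 + real (Suc k)) * \<rho> ^ k"
      using \<rho> by (intro mult_right_mono) auto
  qed (use K \<rho> in auto)
  also have "\<dots> = L * ((1 + real (Suc k)) * \<rho> ^ Suc k)"
    using \<rho> by (simp add: L_def field_simps)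
  finally show "K * \<rho> ^ k + K * (real k * \<rho> ^ (k - 1) * K) \<le> L * ((1 + real (Suc k)) * \<rho> ^ Suc k)" .
qed

lemma mobius_seq_deriv_bound:
  assumes \<rho>: "0 < \<rho>" "\<rho> < 1" "cmod p \<le> \<rho>"
    and K: "cmod b' \<le> K" "cmod c \<le> K" "cmod c' \<le> K" "cmod p' \<le> K" "0 \<le> K"
  shows "cmod (mobius_seq_deriv b' c p c' p' n) \<le> (K + K * K / \<rho>) / \<rho> * ((1 + real n) * \<rho> ^ n)"
proof (cases n)
  case 0
  then show ?thesis
    using K order_trans[OF K(1) power_majorant(1)[OF \<rho>(1,2) K(5)]] by (simp add: mobius_seq_deriv_def)
next
  case (Suc k)
  have "cmod (mobius_seq_deriv b' c p c' p' n) \<le> cmod c' * cmod p ^ k + cmod c * (real k * cmod p ^ (k - 1) * cmod p')"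
    unfolding Suc mobius_seq_deriv_def nat.case
    by (rule order_trans[OF norm_triangle_ineq]) (simp add: norm_mult norm_power)
  also have "\<dots> \<le> K * \<rho> ^ k + K * (real k * \<rho> ^ (k - 1) * K)"
    using \<rho> K by (intro add_mono mult_mono power_mono) auto
  also have "\<dots> \<le> (K + K * K / \<rho>) / \<rho> * ((1 + real n) * \<rho> ^ n)"
    unfolding Suc by (rule power_majorant(2)[OF \<rho>(1,2) K(5)])
  finally show ?thesis .
qed

lemma mobius_seq_diff_quotient_bound:
  assumes \<rho>: "0 < \<rho>" "\<rho> < 1" "cmod p \<le> \<rho>" "cmod q \<le> \<rho>"
    and K: "cmod ((b2 - b1) / h) \<le> K" "cmod c2 \<le> K" "cmod ((c2 - c1) / h) \<le> K" "cmod ((q - p) / h) \<le> K" "0 \<le> K"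
  shows "cmod ((mobius_seq b2 c2 q n - mobius_seq b1 c1 p n) / h) \<le> (K + K * K / \<rho>) / \<rho> * ((1 + real n) * \<rho> ^ n)"
proof (cases n)
  case 0
  then show ?thesis
    using order_trans[OF K(1) power_majorant(1)[OF \<rho>(1,2) K(5)]] by simp
next
  case (Suc k)
  have "(mobius_seq b2 c2 q n - mobius_seq b1 c1 p n) / h = (c2 - c1) / h * p ^ k + c2 * ((q ^ k - p ^ k) / h)"
    by (simp add: Suc diff_divide_distrib algebra_simps)
  then have "cmod ((mobius_seq b2 c2 q n - mobius_seq b1 c1 p n) / h) \<le>
      cmod ((c2 - c1) / h) * cmod p ^ k + cmod c2 * (cmod (q ^ k - p ^ k) / cmod h)"
    by (metis norm_mult norm_power norm_triangle_ineq norm_divide)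
  also have "\<dots> \<le> cmod ((c2 - c1) / h) * cmod p ^ k + cmod c2 * (real k * \<rho> ^ (k - 1) * cmod (q - p) / cmod h)"
    using \<rho> by (intro add_mono mult_left_mono divide_right_mono norm_power_diff_le) auto
  also have "\<dots> = cmod ((c2 - c1) / h) * cmod p ^ k + cmod c2 * (real k * \<rho> ^ (k - 1) * cmod ((q - p) / h))"
    by (simp add: norm_divide)
  also have "\<dots> \<le> K * \<rho> ^ k + K * (real k * \<rho> ^ (k - 1) * K)"
    using \<rho> K by (intro add_mono mult_mono power_mono) auto
  also have "\<dots> \<le> (K + K * K / \<rho>) / \<rho> * ((1 + real n) * \<rho> ^ n)"
    unfolding Suc by (rule power_majorant(2)[OF \<rho>(1,2) K(5)])
  finally show ?thesis .
qed

lemma summable_sobolev_majorant: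
  assumes "0 < \<rho>" "\<rho> < 1" "s > 0"
  shows "summable (\<lambda>n. (1 + real n) powr (2 * s) * (L * ((1 + real n) * \<rho> ^ n))\<^sup>2)"
proof -
  have "summable (\<lambda>n. L\<^sup>2 * ((1 + real n) powr (2 * s + 2) * (\<rho>\<^sup>2) ^ n))"
    using assms by (intro summable_mult powr_geometric_series_upper(1)) (auto simp: abs_square_less_1)
  moreover have "L\<^sup>2 * ((1 + real n) powr (2 * s + 2) * (\<rho>\<^sup>2) ^ n) =
      (1 + real n) powr (2 * s) * (L * ((1 + real n) * \<rho> ^ n))\<^sup>2" for n
    by (simp add: powr_add power_mult_distrib mult_ac flip: power_mult powr_numeral)
  ultimately show ?thesis by simp
qed

lemma mobius_seq_deriv_in_sobolev_plus:
  assumes p: "cmod p < 1" and s: "s > 0"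
  shows "mobius_seq_deriv b' c p c' p' \<in> sobolev_plus s"
proof -
  define \<rho> where "\<rho> = (1 + cmod p) / 2"
  have \<rho>: "0 < \<rho>" "\<rho> < 1" "cmod p \<le> \<rho>"
    using p norm_ge_zero[of "p"] by (simp_all add: \<rho>_def add_pos_nonneg)
  define K where "K = cmod b' + cmod c + cmod c' + cmod p'"
  have "cmod (mobius_seq_deriv b' c p c' p' n) \<le> (K + K * K / \<rho>) / \<rho> * ((1 + real n) * \<rho> ^ n)" for n
    by (rule mobius_seq_deriv_bound[OF \<rho>]) (auto simp: K_def)
  then have "(1 + real n) powr (2 * s) * (cmod (mobius_seq_deriv b' c p c' p' n))\<^sup>2 \<le>
      (1 + real n) powr (2 * s) * ((K + K * K / \<rho>) / \<rho> * ((1 + real n) * \<rho> ^ n))\<^sup>2" for n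
    by (intro mult_left_mono power_mono) auto
  then show ?thesis
    unfolding sobolev_plus_def mem_Collect_eq
    by (intro summable_comparison_test'[OF summable_sobolev_majorant[OF \<rho>(1,2) s, of "(K + K * K / \<rho>) / \<rho>"], where N = 0])
       (simp only: real_norm_def abs_mult abs_power2 abs_of_nonneg[OF powr_ge_zero])
qed

text \<open>Tannery's theorem: each coefficient of the error tends to 0, and since
  \<open>|p|\<close> stays below a fixed \<open>\<rho> < 1\<close> near \<open>t\<close>, the
  weighted squares have a summable majorant that does not depend on \<open>h\<close>.\<close>

lemma mobius_seq_has_sobolev_derivative:
  assumes db: "(b has_vector_derivative b') (at t)" and dc: "(c has_vector_derivative c') (at t)"
    and dp: "(p has_vector_derivative p') (at t)" and p: "cmod (p t) < 1" and s: "s > 0"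
  shows "has_sobolev_derivative s (\<lambda>t. mobius_seq (b t) (c t) (p t)) (mobius_seq_deriv b' (c t) (p t) c' p') t"
proof -
  let ?u = "\<lambda>t. mobius_seq (b t) (c t) (p t)" and ?D = "mobius_seq_deriv b' (c t) (p t) c' p'"
  let ?q = "\<lambda>h n. (?u (t + h) n - ?u t n) / of_real h - ?D n"
  let ?a = "\<lambda>n h. (1 + real n) powr (2 * s) * (cmod (?q h n))\<^sup>2"
  define \<rho> where "\<rho> = (1 + cmod (p t)) / 2"
  have \<rho>: "0 < \<rho>" "\<rho> < 1" "cmod (p t) < \<rho>"
    using p norm_ge_zero[of "p t"] by (simp_all add: \<rho>_def add_pos_nonneg)
  define K where "K = 1 + cmod b' + cmod c' + cmod p' + cmod (c t)"
  define L\<^sub>0 where "L\<^sub>0 = (K + K * K / \<rho>) / \<rho>"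
  define L where "L = 2 * L\<^sub>0"
  have K: "cmod b' < K" "cmod c' < K" "cmod p' < K" "cmod (c t) < K" "0 \<le> K"
    by (auto simp: K_def intro!: add_nonneg_nonneg add_strict_increasing2 simp: add_pos_nonneg add_nonneg_pos)
  have cont: "((\<lambda>h. f (t + h)) \<longlongrightarrow> f t) (at 0)" if "(f has_vector_derivative f') (at t)" for f :: "real \<Rightarrow> complex" and f'
    using has_vector_derivative_continuous[OF that] by (simp add: isCont_def LIM_offset_zero_iff)
  have "\<forall>\<^sub>F h in at 0. cmod ((b (t + h) - b t) / of_real h) < K"
    "\<forall>\<^sub>F h in at 0. cmod ((c (t + h) - c t) / of_real h) < K"
    "\<forall>\<^sub>F h in at 0. cmod ((p (t + h) - p t) / of_real h) < K"
    "\<forall>\<^sub>F h in at 0. cmod (c (t + h)) < K"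
    "\<forall>\<^sub>F h in at 0. cmod (p (t + h)) < \<rho>"
    using K \<rho> by (auto intro!: order_tendstoD(2)[OF tendsto_norm] has_vector_derivative_quotient db dc dp cont[OF dc] cont[OF dp]
      simp del: norm_divide)
  then have ev: "\<forall>\<^sub>F h in at 0. \<forall>n. norm (?a n h) \<le> (1 + real n) powr (2 * s) * (L * ((1 + real n) * \<rho> ^ n))\<^sup>2"
  proof eventually_elim
    case (elim h)
    show ?case
    proof
      fix n
      have "cmod ((?u (t + h) n - ?u t n) / of_real h) \<le> L\<^sub>0 * ((1 + real n) * \<rho> ^ n)"
        unfolding L\<^sub>0_def by (rule mobius_seq_diff_quotient_bound) (use \<rho> K elim in auto)
      moreover have "cmod (?D n) \<le> L\<^sub>0 * ((1 + real n) * \<rho> ^ n)"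
        unfolding L\<^sub>0_def by (rule mobius_seq_deriv_bound) (use \<rho> K in auto)
      moreover have "cmod (?q h n) \<le> cmod ((?u (t + h) n - ?u t n) / of_real h) + cmod (?D n)"
        by (rule norm_triangle_ineq4)
      ultimately have "cmod (?q h n) \<le> L * ((1 + real n) * \<rho> ^ n)"
        unfolding L_def mult.assoc[of 2] by linarith
      then have "?a n h \<le> (1 + real n) powr (2 * s) * (L * ((1 + real n) * \<rho> ^ n))\<^sup>2"
        by (intro mult_left_mono power_mono) auto
      then show "norm (?a n h) \<le> (1 + real n) powr (2 * s) * (L * ((1 + real n) * \<rho> ^ n))\<^sup>2"
        by simp
    qed
  qed
  have bound: "\<forall>\<^sub>F (n, h) in at_top \<times>\<^sub>F at 0. norm (?a n h) \<le> (1 + real n) powr (2 * s) * (L * ((1 + real n) * \<rho> ^ n))\<^sup>2"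
    by (rule eventually_mono[OF eventually_prodI[OF eventually_True ev]]) (unfold case_prod_beta, blast)
  have lim: "((\<lambda>h. ?a n h) \<longlongrightarrow> 0) (at 0)" for n
  proof -
    have "((\<lambda>h. (?u (t + h) n - ?u t n) / of_real h) \<longlongrightarrow> ?D n) (at 0)"
      by (rule has_vector_derivative_quotient[OF mobius_seq_has_vector_derivative[OF db dc dp]])
    then have "((\<lambda>h. ?q h n) \<longlongrightarrow> 0) (at 0)"
      by (rule LIM_zero)
    then have "((\<lambda>h. ?a n h) \<longlongrightarrow> (1 + real n) powr (2 * s) * (cmod 0)\<^sup>2) (at 0)"
      by (intro tendsto_intros)
    then show ?thesis by simp
  qed
  have "((\<lambda>h. suminf (\<lambda>n. ?a n h)) \<longlongrightarrow> suminf (\<lambda>n. 0)) (at 0)"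
    using tannerys_theorem[OF lim bound summable_sobolev_majorant[OF \<rho>(1,2) s]] by simp
  then have "((\<lambda>h. sqrt (suminf (\<lambda>n. ?a n h))) \<longlongrightarrow> sqrt 0) (at 0)"
    by (intro tendsto_intros) simp
  then show ?thesis
    unfolding has_sobolev_derivative_def sobolev_norm_def by simp
qed

lemma mobius_seq_solution:
  fixes b c p :: "real \<Rightarrow> complex" and \<beta> :: real
  defines "Y \<equiv> \<lambda>t. 1 / (1 - p t * cnj (p t))"
  assumes p: "\<And>t. cmod (p t) < 1" and s: "s > 0"
    and db: "\<And>t. (b has_vector_derivative - \<i> * (cnj (b t) * (b t)\<^sup>2 + 2 * b t * c t * cnj (c t) * Y t
        + (c t)\<^sup>2 * cnj (c t) * cnj (p t) * (Y t)\<^sup>2)) (at t)"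
    and dc: "\<And>t. (c has_vector_derivative - \<i> * (2 * b t * cnj (b t) * c t + 2 * b t * c t * cnj (c t) * p t * Y t
        + (1 - of_real \<beta>) * (c t)\<^sup>2 * cnj (c t) * (Y t)\<^sup>2)) (at t)"
    and dp: "\<And>t. (p has_vector_derivative - \<i> * (cnj (b t) * c t + (1 - of_real \<beta>) * c t * cnj (c t) * p t * Y t)) (at t)"
  shows "beta_szego_solution \<beta> s (mobius_seq (b 0) (c 0) (p 0)) (\<lambda>t. mobius_seq (b t) (c t) (p t))"
proof -
  define b' where "b' t = - \<i> * (cnj (b t) * (b t)\<^sup>2 + 2 * b t * c t * cnj (c t) * Y t
        + (c t)\<^sup>2 * cnj (c t) * cnj (p t) * (Y t)\<^sup>2)" for t
  define c' where "c' t = - \<i> * (2 * b t * cnj (b t) * c t + 2 * b t * c t * cnj (c t) * p t * Y t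
        + (1 - of_real \<beta>) * (c t)\<^sup>2 * cnj (c t) * (Y t)\<^sup>2)" for t
  define p' where "p' t = - \<i> * (cnj (b t) * c t + (1 - of_real \<beta>) * c t * cnj (c t) * p t * Y t)" for t
  define D where "D t = mobius_seq_deriv (b' t) (c t) (p t) (c' t) (p' t)" for t
  have "has_sobolev_derivative s (\<lambda>t. mobius_seq (b t) (c t) (p t)) (D t) t" for t
    unfolding D_def b'_def c'_def p'_def
    by (rule mobius_seq_has_sobolev_derivative[OF db dc dp p s])
  moreover have "D t \<in> sobolev_plus s" for t
    unfolding D_def by (rule mobius_seq_deriv_in_sobolev_plus[OF p s])
  moreover have "\<i> * D t n = beta_szego_rhs \<beta> (mobius_seq (b t) (c t) (p t)) n" for t n
  proof -
    have ib: "\<i> * b' t = cnj (b t) * (b t)\<^sup>2 + 2 * b t * c t * cnj (c t) * Y t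
        + (c t)\<^sup>2 * cnj (c t) * cnj (p t) * (Y t)\<^sup>2"
      by (simp add: b'_def flip: mult.assoc)
    have ic: "\<i> * c' t = 2 * b t * cnj (b t) * c t + 2 * b t * c t * cnj (c t) * p t * Y t
        + (1 - of_real \<beta>) * (c t)\<^sup>2 * cnj (c t) * (Y t)\<^sup>2"
      by (simp add: c'_def flip: mult.assoc)
    have ip: "\<i> * p' t = cnj (b t) * c t + (1 - of_real \<beta>) * c t * cnj (c t) * p t * Y t"
      by (simp add: p'_def flip: mult.assoc)
    have "\<i> * D t n = (case n of 0 \<Rightarrow> \<i> * b' t | Suc k \<Rightarrow> (\<i> * c' t) * p t ^ k + c t * (of_nat k * p t ^ (k - 1)) * (\<i> * p' t))"
      by (cases n) (simp_all add: D_def mobius_seq_deriv_def algebra_simps)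
    then show ?thesis
      unfolding ib ic ip beta_szego_rhs_mobius_seq[OF p] Y_def .
  qed
  ultimately show ?thesis
    unfolding beta_szego_solution_def using mobius_seq_sobolev(1)[OF p s] by blast
qed

section \<open>An orbit with polynomial growth\<close>

lemma has_vector_derivative_polar:
  assumes "(r has_real_derivative r') (at t)" "(\<phi> has_real_derivative \<phi>') (at t)"
  shows "((\<lambda>t. of_real (r t) * cis (- \<phi> t)) has_vector_derivative
    (of_real r' - \<i> * of_real (r t * \<phi>')) * cis (- \<phi> t)) (at t)"
proof -
  have 1: "((\<lambda>t. complex_of_real (r t)) has_vector_derivative of_real r') (at t)"
    using assms(1) by (rule has_vector_derivative_of_real)
  have 2: "((\<lambda>t. complex_of_real (\<phi> t)) has_vector_derivative of_real \<phi>') (at t)"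
    using assms(2) by (rule has_vector_derivative_of_real)
  have "((\<lambda>z. exp (- (\<i> * z))) has_field_derivative - (\<i> * exp (- (\<i> * of_real (\<phi> t))))) (at (of_real (\<phi> t)))"
    by (auto intro!: derivative_eq_intros)
  from field_vector_diff_chain_at[OF 2 this]
  have "((\<lambda>t. cis (- \<phi> t)) has_vector_derivative - (\<i> * of_real \<phi>' * cis (- \<phi> t))) (at t)"
    by (simp add: o_def cis_conv_exp mult_ac)
  from has_vector_derivative_mult[OF 1 this] show ?thesis
    by (simp add: algebra_simps)
qed

lemma has_real_antiderivative:
  fixes g :: "real \<Rightarrow> real"
  assumes "continuous_on UNIV g"
  shows "\<exists>G. \<forall>t. (G has_real_derivative g t) (at t)"
proof -
  have "isCont g x" for x
    using assms by (simp add: continuous_on_eq_continuous_at)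
  then have "\<exists>G. \<forall>x. - \<infinity> < ereal x \<longrightarrow> ereal x < \<infinity> \<longrightarrow> (G has_vector_derivative g x) (at x)"
    by (intro einterval_antiderivative) auto
  then show ?thesis
    by (simp add: has_real_derivative_iff_has_vector_derivative)
qed

text \<open>
  With \<open>\<beta> = q\<^sup>2\<close> and momentum \<open>|c|\<^sup>2/y\<^sup>2 = 1\<close>, where \<open>y = 1 - |p|\<^sup>2\<close>, conservation of mass and energy leaves
  a first-order ODE for \<open>y\<close>. The mass \<open>N = (q - 1)\<^sup>2\<close> is chosen so that it reads \<open>y'\<^sup>2 = 4y\<^sup>3(A - By)\<close>, whose
  solution decays like \<open>t\<^sup>-\<^sup>2\<close>; \<open>A > 0\<close> is where \<open>q > 3\<close> enters. Energy conservation gives the real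
  part \<open>R\<close> of \<open>Z\<close>, which is \<open>c\<close> times the conjugates of \<open>b\<close> and \<open>p\<close>, and \<open>y' = -2 Im Z\<close> gives the imaginary part \<open>I\<close>.
\<close>

locale growing_orbit =
  fixes q :: real
  assumes q: "q > 3"
begin

text \<open>If \<open>|c| = y\<close> and \<open>|b|^2 = N - y\<close>, the mean of
  \<open>|u|^4 - q^2 |shift_adj u|^4\<close> is
  \<open>N^2 + 2 N y - 3 y^2 + (1 - q^2) (2 y - y^2) + 4 R\<close>. The energy value
  \<open>N^2\<close> removes the constant term of \<open>R\<close>, leaving
  \<open>R = (q^2 - 1 - N) y / 2 - (q^2 - 4) y^2 / 4\<close>. In \<open>|Z|^2 - R^2\<close> the
  coefficient of \<open>y^2\<close> vanishes iff \<open>4 N = (q^2 - 1 - N)^2\<close>, that is, for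
  \<open>N = (q - 1)^2\<close> or \<open>N = (q + 1)^2\<close>; the coefficients of
  \<open>y^3\<close> and \<open>y^4\<close> are then \<open>A\<close> and \<open>- B\<close>. The
  root \<open>(q + 1)^2\<close> would make the coefficient of \<open>y^3\<close> negative.\<close>

definition "N = (q - 1)\<^sup>2"
definition "A = q\<^sup>2 * (q - 3) / 2"
definition "B = q\<^sup>2 * (q\<^sup>2 - 8) / 16"
text \<open>For \<open>x = 1 / y\<close> the equation \<open>y'^2 = 4 y^3 (A - B y)\<close> becomes
  \<open>x'^2 = 4 (A x - B)\<close>, which \<open>x = B / A + A t^2\<close> solves; time 0 is the
  turning point.\<close>

definition "y t = A / (B + A\<^sup>2 * t\<^sup>2)"
definition "R t = (q - 1) * y t - (q\<^sup>2 - 4) * (y t)\<^sup>2 / 4"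
definition "I t = A * t * (y t)\<^sup>2"

lemma A_pos: "0 < A"
  unfolding A_def using q by (intro divide_pos_pos mult_pos_pos) auto

text \<open>This makes \<open>y \<le> 1\<close>, as \<open>y = 1 - |p|^2\<close> demands. Equality
  occurs exactly at \<open>q = 4\<close>, where \<open>p\<close> vanishes at time 0.\<close>

lemma A_le_B: "A \<le> B"
proof -
  have "B - A = (q * (q - 4) / 4)\<^sup>2"
    by (simp add: A_def B_def power2_eq_square field_simps)
  then show ?thesis using zero_le_power2[of "q * (q - 4) / 4"] by linarith
qed

lemma N_gt_1: "1 < N"
  unfolding N_def using q by (simp add: one_less_power)

lemma denominator_pos: "0 < B + A\<^sup>2 * t\<^sup>2"
  using A_pos A_le_B by (simp add: add_pos_nonneg)

lemma y_pos: "0 < y t" and y_le_1: "y t \<le> 1"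
proof -
  show "0 < y t" unfolding y_def using A_pos denominator_pos by simp
  have "0 \<le> A\<^sup>2 * t\<^sup>2" by simp
  then have "A \<le> B + A\<^sup>2 * t\<^sup>2" using A_le_B by linarith
  then show "y t \<le> 1" unfolding y_def using denominator_pos[of t] by simp
qed

lemma y_less_N: "0 < N - y t"
  using N_gt_1 y_le_1[of t] by linarith

lemma y_relation: "A\<^sup>2 * t\<^sup>2 * y t = A - B * y t"
proof -
  have "y t * (B + A\<^sup>2 * t\<^sup>2) = A"
    using denominator_pos[of t] by (simp add: y_def)
  then show ?thesis by (simp add: algebra_simps)
qed

lemma I_power2: "(I t)\<^sup>2 = (y t) ^ 3 * (A - B * y t)"
  unfolding y_relation[symmetric] I_def by (simp add: power2_eq_square power3_eq_cube)

text \<open>In terms of the orbit this is \<open>|Z|^2 = |b|^2 |c|^2 |p|^2\<close>. The relation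
  \<open>|p|^2 = 1 - y\<close> will be deduced from it, since \<open>p\<close> is defined through
  \<open>Z\<close>.\<close>

lemma R_I_power2: "(R t)\<^sup>2 + (I t)\<^sup>2 = (N - y t) * (y t)\<^sup>2 * (1 - y t)"
  unfolding I_power2 R_def N_def A_def B_def by (simp add: power2_eq_square power3_eq_cube field_simps)

lemma DERIV_y: "(y has_real_derivative - 2 * I t) (at t)"
proof -
  have "(y has_real_derivative - (A * (2 * A\<^sup>2 * t)) / (B + A\<^sup>2 * t\<^sup>2)\<^sup>2) (at t)"
    unfolding y_def[abs_def] using denominator_pos[of t]
    by (auto intro!: derivative_eq_intros simp: power2_eq_square)
  then show ?thesis
    by (rule DERIV_cong) (simp add: I_def y_def power2_eq_square)
qed

lemma DERIV_R: "(R has_real_derivative - 2 * I t * ((q - 1) - (q\<^sup>2 - 4) * y t / 2)) (at t)"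
proof -
  have "(R has_real_derivative (q - 1) * (- 2 * I t) - (q\<^sup>2 - 4) * (2 * y t * (- 2 * I t)) / 4) (at t)"
    unfolding R_def[abs_def] by (auto intro!: derivative_eq_intros DERIV_y)
  then show ?thesis
    by (rule DERIV_cong) (simp add: algebra_simps diff_divide_distrib)
qed

lemma DERIV_I: "(I has_real_derivative - 3 * A * (y t)\<^sup>2 + 4 * B * (y t) ^ 3) (at t)"
proof -
  have "A * (y t)\<^sup>2 + A * t * (2 * y t * (- 2 * I t)) = A * (y t)\<^sup>2 - 4 * (A\<^sup>2 * t\<^sup>2 * y t) * (y t)\<^sup>2"
    by (simp add: I_def power2_eq_square)
  also have "\<dots> = - 3 * A * (y t)\<^sup>2 + 4 * B * (y t) ^ 3"
    unfolding y_relation by (simp add: power2_eq_square power3_eq_cube algebra_simps)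
  finally have eq: "A * (y t)\<^sup>2 + A * t * (2 * y t * (- 2 * I t)) = - 3 * A * (y t)\<^sup>2 + 4 * B * (y t) ^ 3" .
  have "((\<lambda>t. A * t * (y t)\<^sup>2) has_real_derivative A * (y t)\<^sup>2 + A * t * (2 * y t * (- 2 * I t))) (at t)"
    by (auto intro!: derivative_eq_intros DERIV_y)
  moreover have "I = (\<lambda>t. A * t * (y t)\<^sup>2)"
    by (simp add: fun_eq_iff I_def)
  ultimately show ?thesis
    unfolding eq by (simp only:)
qed

section \<open>Phases by quadrature, and the parameters \<open>b\<close>, \<open>c\<close>,
  \<open>p\<close>\<close>

lemma continuous_y: "continuous_on UNIV y" and continuous_R: "continuous_on UNIV R"
  using DERIV_y DERIV_R by (blast intro: continuous_at_imp_continuous_on DERIV_isCont)+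

text \<open>The two integrands are the real parts of \<open>G\<close> and \<open>H\<close> below,
  where \<open>i b' = G b\<close> and \<open>i c' = H c\<close> are the equations for
  \<open>b\<close> and \<open>c\<close> rewritten in \<open>y\<close> and \<open>Z\<close>. The
  constants of integration left open by \<open>SOME\<close> reflect two symmetries of the equation:
  multiplication of \<open>u\<close> by a unimodular constant and rotation of the circle.\<close>

definition "\<Phi> = (SOME \<Phi>. \<forall>t. (\<Phi> has_real_derivative N + y t + R t / (N - y t)) (at t))"
definition "\<Psi> = (SOME \<Psi>. \<forall>t. (\<Psi> has_real_derivative 2 * (N - y t) + 2 * R t / y t + 1 - q\<^sup>2) (at t))"

lemma DERIV_\<Phi>: "(\<Phi> has_real_derivative N + y t + R t / (N - y t)) (at t)"
proof -
  have "continuous_on UNIV (\<lambda>t. N + y t + R t / (N - y t))"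
    using y_less_N less_imp_neq by (intro continuous_intros continuous_y continuous_R) fastforce
  then have "\<exists>\<Phi>. \<forall>t. (\<Phi> has_real_derivative N + y t + R t / (N - y t)) (at t)"
    by (rule has_real_antiderivative)
  from someI_ex[OF this] show ?thesis
    unfolding \<Phi>_def by blast
qed

lemma DERIV_\<Psi>: "(\<Psi> has_real_derivative 2 * (N - y t) + 2 * R t / y t + 1 - q\<^sup>2) (at t)"
proof -
  have "continuous_on UNIV (\<lambda>t. 2 * (N - y t) + 2 * R t / y t + 1 - q\<^sup>2)"
    using y_pos less_imp_neq by (intro continuous_intros continuous_y continuous_R) fastforce
  then have "\<exists>\<Psi>. \<forall>t. (\<Psi> has_real_derivative 2 * (N - y t) + 2 * R t / y t + 1 - q\<^sup>2) (at t)"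
    by (rule has_real_antiderivative)
  from someI_ex[OF this] show ?thesis
    unfolding \<Psi>_def by blast
qed

definition "Z t = Complex (R t) (I t)"
definition "b t = of_real (sqrt (N - y t)) * cis (- \<Phi> t)"
definition "c t = of_real (y t) * cis (- \<Psi> t)"
text \<open>Obtained by solving \<open>Z = c * cnj b * cnj p\<close> for \<open>p\<close>. Polar
  coordinates would break down for \<open>p\<close>, which vanishes at time 0 if
  \<open>q = 4\<close>, whereas \<open>b\<close> and \<open>c\<close> have no zeros.\<close>

definition "p t = cnj (Z t) * inverse (b t * cnj (c t))"

lemma nonzero: "complex_of_real (y t) \<noteq> 0" "complex_of_real (N - y t) \<noteq> 0" "b t \<noteq> 0" "c t \<noteq> 0"
  using y_less_N[of t] y_pos[of t] by (auto simp: b_def c_def)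

lemma b_cnj_b: "b t * cnj (b t) = of_real (N - y t)"
  using y_less_N[of t] by (simp only: complex_norm_square[symmetric]) (simp add: b_def norm_mult)

lemma c_cnj_c: "c t * cnj (c t) = of_real ((y t)\<^sup>2)"
  using y_pos[of t] by (simp only: complex_norm_square[symmetric]) (simp add: c_def norm_mult)

lemma Z_cnj_Z: "Z t * cnj (Z t) = of_real ((N - y t) * (y t)\<^sup>2 * (1 - y t))"
  unfolding R_I_power2[symmetric] by (simp add: Z_def complex_eq_iff power2_eq_square)

lemma b_cnj_c_p: "b t * cnj (c t) * p t = cnj (Z t)"
proof -
  have nz: "b t * cnj (c t) \<noteq> 0" using nonzero[of t] by simp
  have "b t * cnj (c t) * p t = cnj (Z t) * (b t * cnj (c t) * inverse (b t * cnj (c t)))"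
    unfolding p_def by (rule mult.left_commute)
  then show ?thesis
    unfolding right_inverse[OF nz] by simp
qed

text \<open>This turns the coupling term \<open>c * cnj p\<close> in the equation for
  \<open>b\<close> into a multiple of \<open>b\<close>, as the form \<open>i b' = G b\<close>
  requires.\<close>

lemma c_cnj_p: "c t * cnj (p t) = Z t / of_real (N - y t) * b t"
proof -
  have "(b t * cnj (b t)) * (c t * cnj (p t)) = cnj (b t * cnj (c t) * p t) * b t"
    by simp
  then have "of_real (N - y t) * (c t * cnj (p t)) = Z t * b t"
    unfolding b_cnj_b b_cnj_c_p by simp
  then show ?thesis
    using nonzero(2)[of t] by (simp add: nonzero_eq_divide_eq mult.commute del: of_real_diff)
qed

lemma p_cnj_p: "p t * cnj (p t) = of_real (1 - y t)"
proof -
  have "of_real ((N - y t) * (y t)\<^sup>2) * (p t * cnj (p t)) = (b t * cnj (b t)) * (c t * cnj (c t)) * (p t * cnj (p t))"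
    unfolding b_cnj_b c_cnj_c by simp
  also have "\<dots> = (b t * cnj (c t) * p t) * cnj (b t * cnj (c t) * p t)"
    by simp
  also have "\<dots> = of_real ((N - y t) * (y t)\<^sup>2) * of_real (1 - y t)"
    unfolding b_cnj_c_p complex_cnj_cnj mult.commute[of "cnj (Z t)"] Z_cnj_Z by simp
  finally show ?thesis
    using nonzero[of t] by (simp del: of_real_diff)
qed

lemma cmod_p_power2: "(cmod (p t))\<^sup>2 = 1 - y t"
  using p_cnj_p[of t] by (metis complex_norm_square of_real_eq_iff)

lemma cmod_p_less_1: "cmod (p t) < 1"
  using cmod_p_power2[of t] y_pos[of t] abs_square_less_1[of "cmod (p t)"] by simp

definition "G t = of_real (N + y t) + Z t / of_real (N - y t)"
definition "H t = of_real (2 * (N - y t) + 1 - q\<^sup>2) + 2 * cnj (Z t) / of_real (y t)"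

text \<open>The real part of \<open>G\<close> is built into the phase. Its imaginary part
  \<open>I / (N - y)\<close> is the logarithmic derivative of the modulus
  \<open>sqrt (N - y)\<close>, because \<open>y' = - 2 I\<close>.\<close>

lemma deriv_b: "(b has_vector_derivative - \<i> * (G t * b t)) (at t)"
proof -
  let ?r = "sqrt (N - y t)"
  have "((\<lambda>t. sqrt (N - y t)) has_real_derivative inverse ?r / 2 * (2 * I t)) (at t)"
    using DERIV_chain2[where f = sqrt and g = "\<lambda>t. N - y t", OF DERIV_real_sqrt[OF y_less_N]
        DERIV_diff[OF DERIV_const DERIV_y]] by simp
  then have "((\<lambda>t. sqrt (N - y t)) has_real_derivative I t / (N - y t) * ?r) (at t)"
  proof (rule DERIV_cong)
    have "I t / (N - y t) * ?r = I t * (?r / (N - y t))" by simp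
    also have "\<dots> = I t * inverse ?r"
      by (simp only: sqrt_divide_self_eq[OF less_imp_le[OF y_less_N]])
    finally show "inverse ?r / 2 * (2 * I t) = I t / (N - y t) * ?r" by simp
  qed
  from has_vector_derivative_polar[OF this DERIV_\<Phi>]
  have "(b has_vector_derivative (of_real (I t / (N - y t) * ?r) -
      \<i> * of_real (?r * (N + y t + R t / (N - y t)))) * cis (- \<Phi> t)) (at t)"
    by (simp only: b_def[abs_def])
  moreover have "of_real (I t / (N - y t) * ?r) - \<i> * of_real (?r * (N + y t + R t / (N - y t))) =
      - \<i> * (G t * of_real ?r)"
    by (simp add: G_def Z_def complex_eq_iff Re_divide_of_real Im_divide_of_real algebra_simps del: of_real_diff)
  ultimately show ?thesis by (simp only: b_def mult.assoc)
qed

lemma deriv_c: "(c has_vector_derivative - \<i> * (H t * c t)) (at t)"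
proof -
  have eq: "y t * (2 * (N - y t) + 2 * R t / y t + 1 - q\<^sup>2) = y t * (2 * (N - y t) + 1 - q\<^sup>2) + 2 * R t"
    using y_pos[of t] by (simp add: field_simps)
  from has_vector_derivative_polar[OF DERIV_y DERIV_\<Psi>]
  have "(c has_vector_derivative (of_real (- 2 * I t) -
      \<i> * of_real (y t * (2 * (N - y t) + 2 * R t / y t + 1 - q\<^sup>2))) * cis (- \<Psi> t)) (at t)"
    by (simp only: c_def[abs_def])
  moreover have "of_real (- 2 * I t) - \<i> * of_real (y t * (2 * (N - y t) + 2 * R t / y t + 1 - q\<^sup>2)) =
      - \<i> * (H t * of_real (y t))"
    unfolding eq complex_eq_iff H_def Z_def using y_pos[of t]
    by (simp add: Re_divide_of_real Im_divide_of_real distrib_left distrib_right mult.commute del: of_real_power)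
  ultimately show ?thesis by (simp only: c_def mult.assoc)
qed

definition "Z' t = Complex (- 2 * I t * ((q - 1) - (q\<^sup>2 - 4) * y t / 2)) (- 3 * A * (y t)\<^sup>2 + 4 * B * (y t) ^ 3)"

lemma deriv_Z: "(Z has_vector_derivative Z' t) (at t)"
  unfolding Z_def[abs_def] Z'_def Complex_eq
  by (intro has_vector_derivative_add has_vector_derivative_mult_right has_vector_derivative_of_real DERIV_R DERIV_I)

text \<open>The equation for \<open>p\<close> is verified here: by the product rule the left side is
  \<open>b * cnj c\<close> times \<open>p'\<close>, and the right side is what the equation
  prescribes. Once \<open>Z * cnj Z\<close> is expressed in \<open>y\<close>, the real part is
  conservation of energy, and the imaginary part is the identity that involves \<open>A\<close> and
  \<open>B\<close>.\<close>

lemma Z'_eq: "cnj (Z' t) + \<i> * (cnj (Z t) * (G t - cnj (H t))) =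
    - \<i> * (of_real ((N - y t) * (y t)\<^sup>2) + of_real ((1 - q\<^sup>2) * y t) * cnj (Z t))"
proof -
  have 1: "(Z t * cnj (Z t)) / of_real (N - y t) = of_real ((y t)\<^sup>2 * (1 - y t))"
    unfolding Z_cnj_Z using nonzero(2)[of t] by (simp del: of_real_diff)
  have 2: "2 * (Z t * cnj (Z t)) / of_real (y t) = of_real (2 * (N - y t) * y t * (1 - y t))"
    unfolding Z_cnj_Z using nonzero(1)[of t] by (simp add: power2_eq_square)
  have "cnj (Z t) * (G t - cnj (H t)) = of_real (N + y t - 2 * (N - y t) - 1 + q\<^sup>2) * cnj (Z t)
      + (Z t * cnj (Z t)) / of_real (N - y t) - 2 * (Z t * cnj (Z t)) / of_real (y t)"
    unfolding G_def H_def by (simp add: algebra_simps del: of_real_power)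
  then have eq: "cnj (Z t) * (G t - cnj (H t)) = of_real (N + y t - 2 * (N - y t) - 1 + q\<^sup>2) * cnj (Z t)
      + of_real ((y t)\<^sup>2 * (1 - y t)) - of_real (2 * (N - y t) * y t * (1 - y t))"
    unfolding 1 2 .
  have re: "- 2 * I t * ((q - 1) - (q\<^sup>2 - 4) * y t / 2) + (N + y t - 2 * (N - y t) - 1 + q\<^sup>2) * I t =
      - ((1 - q\<^sup>2) * y t * I t)"
    unfolding N_def by (simp add: power2_eq_square field_simps)
  have im: "- (- 3 * A * (y t)\<^sup>2 + 4 * B * (y t) ^ 3) + ((N + y t - 2 * (N - y t) - 1 + q\<^sup>2) * R t
      + (y t)\<^sup>2 * (1 - y t) - 2 * (N - y t) * y t * (1 - y t)) =
      - ((N - y t) * (y t)\<^sup>2 + (1 - q\<^sup>2) * y t * R t)"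
    unfolding N_def R_def A_def B_def by (simp add: power2_eq_square power3_eq_cube field_simps)
  show ?thesis
    unfolding eq complex_eq_iff using re im by (simp add: Z_def Z'_def)
qed

lemma deriv_p: "(p has_vector_derivative - \<i> * (of_real ((N - y t) * (y t)\<^sup>2) + of_real ((1 - q\<^sup>2) * y t) * cnj (Z t))
    * inverse (b t * cnj (c t))) (at t)"
proof -
  let ?w = "\<lambda>t. b t * cnj (c t)"
  have nz: "?w t \<noteq> 0" using nonzero[of t] by simp
  have "((\<lambda>t. cnj (c t)) has_vector_derivative cnj (- \<i> * (H t * c t))) (at t)"
    by (rule bounded_linear.has_vector_derivative[OF bounded_linear_cnj deriv_c])
  from has_vector_derivative_mult[OF deriv_b this]
  have "(?w has_vector_derivative - \<i> * (G t - cnj (H t)) * ?w t) (at t)"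
    by (simp add: algebra_simps)
  moreover have "(inverse has_field_derivative - (inverse (?w t))\<^sup>2) (at (?w t))"
    using DERIV_inverse[OF nz] by (simp add: power2_eq_square)
  ultimately have "((inverse \<circ> ?w) has_vector_derivative - \<i> * (G t - cnj (H t)) * ?w t * - (inverse (?w t))\<^sup>2) (at t)"
    by (rule field_vector_diff_chain_at)
  moreover have "- \<i> * g * w * - (inverse w)\<^sup>2 = \<i> * g * inverse w" if "w \<noteq> 0" for g w :: complex
    using that by (simp add: power2_eq_square)
  note this[OF nz, of "G t - cnj (H t)"]
  ultimately have inv: "((\<lambda>t. inverse (?w t)) has_vector_derivative \<i> * (G t - cnj (H t)) * inverse (?w t)) (at t)"
    by (simp only: o_def)
  have "((\<lambda>t. cnj (Z t)) has_vector_derivative cnj (Z' t)) (at t)"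
    by (rule bounded_linear.has_vector_derivative[OF bounded_linear_cnj deriv_Z])
  from has_vector_derivative_mult[OF this inv]
  have "(p has_vector_derivative (cnj (Z' t) + \<i> * (cnj (Z t) * (G t - cnj (H t)))) * inverse (?w t)) (at t)"
    unfolding p_def[abs_def] distrib_right by (simp only: mult_ac add.commute)
  then show ?thesis unfolding Z'_eq .
qed

lemma solution:
  assumes s: "s > 0"
  shows "beta_szego_solution (q\<^sup>2) s (mobius_seq (b 0) (c 0) (p 0)) (\<lambda>t. mobius_seq (b t) (c t) (p t))"
proof (rule mobius_seq_solution[OF cmod_p_less_1 s])
  fix t
  have Y: "1 / (1 - p t * cnj (p t)) = 1 / of_real (y t)"
    unfolding p_cnj_p by simp
  \<comment> \<open>Momentum 1 means \<open>|c| = y\<close>, so every \<open>|c|^2 Y\<close> in the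
    ansatz equations becomes \<open>y\<close> and every \<open>|c|^2 Y^2\<close> becomes 1.\<close>
  have ratios: "(c t * cnj (c t)) / of_real (y t) = of_real (y t)" "(c t * cnj (c t)) / (of_real (y t))\<^sup>2 = 1"
    unfolding c_cnj_c using nonzero(1)[of t] by (simp_all add: power2_eq_square)
  have "cnj (b t) * (b t)\<^sup>2 + 2 * b t * c t * cnj (c t) * (1 / of_real (y t)) + (c t)\<^sup>2 * cnj (c t) * cnj (p t) * (1 / of_real (y t))\<^sup>2 =
      (b t * cnj (b t)) * b t + 2 * b t * ((c t * cnj (c t)) / of_real (y t)) + (c t * cnj (c t)) / (of_real (y t))\<^sup>2 * (c t * cnj (p t))"
    by (simp add: power2_eq_square mult_ac)
  also have "\<dots> = G t * b t"
    unfolding b_cnj_b ratios c_cnj_p by (simp add: G_def algebra_simps)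
  finally show "(b has_vector_derivative - \<i> * (cnj (b t) * (b t)\<^sup>2 + 2 * b t * c t * cnj (c t) * (1 / (1 - p t * cnj (p t)))
      + (c t)\<^sup>2 * cnj (c t) * cnj (p t) * (1 / (1 - p t * cnj (p t)))\<^sup>2)) (at t)"
    unfolding Y using deriv_b[of t] by (simp only:)
  have "2 * b t * cnj (b t) * c t + 2 * b t * c t * cnj (c t) * p t * (1 / of_real (y t)) + (1 - of_real (q\<^sup>2)) * (c t)\<^sup>2 * cnj (c t) * (1 / of_real (y t))\<^sup>2 =
      2 * (b t * cnj (b t)) * c t + 2 * (b t * cnj (c t) * p t) / of_real (y t) * c t + (1 - of_real (q\<^sup>2)) * c t * ((c t * cnj (c t)) / (of_real (y t))\<^sup>2)"
    by (simp add: power2_eq_square mult_ac)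
  also have "\<dots> = H t * c t"
    unfolding b_cnj_b b_cnj_c_p ratios by (simp add: H_def algebra_simps)
  finally show "(c has_vector_derivative - \<i> * (2 * b t * cnj (b t) * c t + 2 * b t * c t * cnj (c t) * p t * (1 / (1 - p t * cnj (p t)))
      + (1 - of_real (q\<^sup>2)) * (c t)\<^sup>2 * cnj (c t) * (1 / (1 - p t * cnj (p t)))\<^sup>2)) (at t)"
    unfolding Y using deriv_c[of t] by (simp only:)
  have "cnj (b t) * c t = (b t * cnj (b t)) * (c t * cnj (c t)) * inverse (b t * cnj (c t))"
  proof -
    have nz: "b t * cnj (c t) \<noteq> 0" using nonzero[of t] by simp
    have "(b t * cnj (b t)) * (c t * cnj (c t)) * inverse (b t * cnj (c t)) =
        cnj (b t) * c t * (b t * cnj (c t) * inverse (b t * cnj (c t)))"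
      by (simp only: mult_ac)
    then show ?thesis
      unfolding right_inverse[OF nz] by simp
  qed
  then have bc: "cnj (b t) * c t = of_real ((N - y t) * (y t)\<^sup>2) * inverse (b t * cnj (c t))"
    unfolding b_cnj_b c_cnj_c by simp
  have "cnj (b t) * c t + (1 - of_real (q\<^sup>2)) * c t * cnj (c t) * p t * (1 / of_real (y t)) =
      cnj (b t) * c t + (1 - of_real (q\<^sup>2)) * ((c t * cnj (c t)) / of_real (y t)) * p t"
    by (simp add: mult_ac)
  also have "\<dots> = (of_real ((N - y t) * (y t)\<^sup>2) + of_real ((1 - q\<^sup>2) * y t) * cnj (Z t)) * inverse (b t * cnj (c t))"
    unfolding ratios bc by (simp add: p_def distrib_right)
  finally show "(p has_vector_derivative - \<i> * (cnj (b t) * c t + (1 - of_real (q\<^sup>2)) * c t * cnj (c t) * p t * (1 / (1 - p t * cnj (p t))))) (at t)"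
    unfolding Y using deriv_p[of t] by (simp only: mult.assoc)
qed

lemma cmod_c: "cmod (c t) = A / (B + A\<^sup>2 * t\<^sup>2)"
  using y_pos[of t] by (simp add: c_def norm_mult flip: y_def)

lemma one_minus_cmod_p: "1 - (cmod (p t))\<^sup>2 = A / (B + A\<^sup>2 * t\<^sup>2)"
  by (simp add: cmod_p_power2 y_def)

lemma cmod_b_le: "(cmod (b t))\<^sup>2 \<le> N"
  using y_pos[of t] y_less_N[of t] by (simp add: b_def norm_mult)

end

section \<open>From the orbit to the growth of the norms\<close>

lemma comparable_at_top_sqrt:
  assumes "0 < m" "0 < M" "\<And>t. t \<ge> T \<Longrightarrow> m * (g t)\<^sup>2 \<le> (f t)\<^sup>2" "\<And>t. t \<ge> T \<Longrightarrow> (f t)\<^sup>2 \<le> M * (g t)\<^sup>2"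
    and nonneg: "\<And>t. 0 \<le> f t" "\<And>t. 0 \<le> g t"
  shows "comparable_at_top f g"
proof -
  \<comment> \<open>\<open>comparable_at_top\<close> asks for ordered constants; the maximum
    provides them.\<close>
  have "sqrt m * g t \<le> f t" "f t \<le> max (sqrt m) (sqrt M) * g t" if "t \<ge> T" for t
  proof -
    have "sqrt (m * (g t)\<^sup>2) \<le> sqrt ((f t)\<^sup>2)" "sqrt ((f t)\<^sup>2) \<le> sqrt (M * (g t)\<^sup>2)"
      using assms that by (auto intro!: real_sqrt_le_mono simp del: real_sqrt_abs real_sqrt_pow2_iff)
    then have "sqrt m * g t \<le> f t" "f t \<le> sqrt M * g t"
      using nonneg by (simp_all add: real_sqrt_mult)
    moreover have "sqrt M * g t \<le> max (sqrt m) (sqrt M) * g t"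
      using nonneg by (intro mult_right_mono) auto
    ultimately show "sqrt m * g t \<le> f t" "f t \<le> max (sqrt m) (sqrt M) * g t"
      by linarith+
  qed
  then show ?thesis
    unfolding comparable_at_top_def using assms(1)
    by (intro exI[of _ "sqrt m"] exI[of _ "max (sqrt m) (sqrt M)"] exI[of _ T]) auto
qed

lemma mobius_seq_polynomial_growth:
  fixes b c p :: "real \<Rightarrow> complex"
  assumes A: "0 < A" "A \<le> B" and s: "s > 1 / 2"
    and c: "\<And>t. cmod (c t) = A / (B + A\<^sup>2 * t\<^sup>2)"
    and p: "\<And>t. 1 - (cmod (p t))\<^sup>2 = A / (B + A\<^sup>2 * t\<^sup>2)"
    and b: "\<And>t. (cmod (b t))\<^sup>2 \<le> N"
  shows "comparable_at_top (\<lambda>t. sobolev_norm s (mobius_seq (b t) (c t) (p t))) (\<lambda>t. t powr (2 * s - 1))"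
proof -
  define y where "y t = A / (B + A\<^sup>2 * t\<^sup>2)" for t
  \<comment> \<open>\<open>t \<ge> 1\<close> lets \<open>t^2\<close> absorb the constant
    \<open>B / A\<close>, and \<open>t \<ge> sqrt (2 / A)\<close> forces \<open>y \<le> 1/2\<close>,
    so that the lower series bound applies to the ratio \<open>1 - y \<ge> 1/2\<close>.\<close>
  define T where "T = max 1 (sqrt 2 / sqrt A)"
  define a where "a = 2 * s - 1"
  have a: "a > 0" using s by (simp add: a_def)
  have N: "N \<ge> 0" using b[of 0] order_trans zero_le_power2 by blast
  have y: "0 < y t" for t
    using A by (simp add: y_def add_pos_nonneg)
  have cp: "cmod (p t) < 1" for t
    using p[of t] y[of t] abs_square_less_1[of "cmod (p t)"] by (simp add: y_def)
  let ?f = "\<lambda>t. sobolev_norm s (mobius_seq (b t) (c t) (p t))"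
  define K where "K = 2 powr (2 * s) * (6 * (4 * s) powr (2 * s))"
  have K: "K > 0" using s by (simp add: K_def)
  have sq: "(y t)\<^sup>2 * y t powr - (2 * s + 1) = y t powr - a" for t
    using y[of t] by (simp add: a_def flip: powr_numeral powr_add)
  have t_sq: "(t powr a)\<^sup>2 = (t\<^sup>2) powr a" if "t \<ge> T" for t
    using that by (simp add: power2_eq_square powr_mult)
  have yt: "inverse (y t) \<le> (B / A + A) * t\<^sup>2" "A * t\<^sup>2 \<le> inverse (y t)" "y t \<le> 1 / 2" if t: "t \<ge> T" for t
  proof -
    have t1: "1 \<le> t" using t by (simp add: T_def)
    have inv: "inverse (y t) = B / A + A * t\<^sup>2"
      using A by (simp add: y_def field_simps power2_eq_square)
    have "B / A * 1 \<le> B / A * t\<^sup>2"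
      using A t1 by (intro mult_left_mono) auto
    then show "inverse (y t) \<le> (B / A + A) * t\<^sup>2"
      unfolding inv by (simp add: algebra_simps)
    show le: "A * t\<^sup>2 \<le> inverse (y t)"
      unfolding inv using A by simp
    have "sqrt 2 / sqrt A \<le> t" using t by (simp add: T_def)
    then have "(sqrt 2 / sqrt A)\<^sup>2 \<le> t\<^sup>2"
      using A by (intro power_mono) auto
    then have "2 \<le> A * t\<^sup>2"
      using A by (simp add: power_divide field_simps)
    then have "2 \<le> inverse (y t)" using le by linarith
    then show "y t \<le> 1 / 2"
      using y[of t] by (simp add: field_simps)
  qed
  have norm_sq: "(?f t)\<^sup>2 = (cmod (b t))\<^sup>2 + (y t)\<^sup>2 * (\<Sum>k. (2 + real k) powr (2 * s) * (1 - y t) ^ k)" for t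
  proof -
    have "(cmod (p t))\<^sup>2 = 1 - y t" using p[of t] unfolding y_def by linarith
    then show ?thesis
      using mobius_seq_sobolev(2)[where p = "p t" and s = s and b = "b t" and c = "c t", OF cp] s unfolding c y_def[symmetric] by simp
  qed
  have y1: "0 \<le> 1 - y t" "1 - y t < 1" for t
    using p[of t] y[of t] zero_le_power2[of "cmod (p t)"] unfolding y_def[symmetric] by linarith+
  have inv_powr: "y t powr - a = inverse (y t) powr a" for t
    using y[of t] by (simp add: powr_minus inverse_powr)
  show ?thesis
    unfolding a_def[symmetric]
  proof (rule comparable_at_top_sqrt)
    fix t assume t: "t \<ge> T"
    have t1: "1 \<le> t" using t by (simp add: T_def)
    have "exp (- 6) * A powr a * (t powr a)\<^sup>2 = exp (- 6) * (A * t\<^sup>2) powr a"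
      unfolding t_sq[OF t] by (simp add: powr_mult)
    also have "\<dots> \<le> exp (- 6) * inverse (y t) powr a"
      using yt[OF t] A a by (intro mult_left_mono powr_mono2) auto
    also have "\<dots> = (y t)\<^sup>2 * (exp (- 6) * (1 - (1 - y t)) powr - (2 * s + 1))"
      unfolding inv_powr[symmetric] sq[symmetric] by simp
    also have "\<dots> \<le> (y t)\<^sup>2 * (\<Sum>k. (2 + real k) powr (2 * s) * (1 - y t) ^ k)"
      using s y1 yt(3)[OF t] by (intro mult_left_mono powr_geometric_series_shift(3)) auto
    also have "\<dots> \<le> (?f t)\<^sup>2"
      unfolding norm_sq by simp
    finally show "exp (- 6) * A powr a * (t powr a)\<^sup>2 \<le> (?f t)\<^sup>2" .
    have "(?f t)\<^sup>2 \<le> N + (y t)\<^sup>2 * (2 powr (2 * s) * (6 * (2 * (2 * s)) powr (2 * s)) * (1 - (1 - y t)) powr - (2 * s + 1))"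
      unfolding norm_sq using s y1 b by (intro add_mono mult_left_mono powr_geometric_series_shift(2)) auto
    also have "\<dots> = N * 1 + K * inverse (y t) powr a"
      unfolding inv_powr[symmetric] sq[symmetric] K_def by simp
    \<comment> \<open>The bounded contribution of the zeroth mode is absorbed into the growing term,
      as \<open>y \<le> 1\<close> and \<open>a > 0\<close>.\<close>
    also have "\<dots> \<le> N * inverse (y t) powr a + K * inverse (y t) powr a"
      using N K a y[of t] yt(3)[OF t] by (intro add_mono mult_left_mono ge_one_powr_ge_zero) (auto simp: one_le_inverse)
    also have "\<dots> = (N + K) * inverse (y t) powr a"
      by (simp add: algebra_simps)
    also have "\<dots> \<le> (N + K) * ((B / A + A) * t\<^sup>2) powr a"
      using N K a y[of t] yt(1)[OF t] by (intro mult_left_mono powr_mono2) auto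
    also have "\<dots> = (N + K) * (B / A + A) powr a * (t powr a)\<^sup>2"
      unfolding t_sq[OF t] by (simp add: powr_mult)
    finally show "(?f t)\<^sup>2 \<le> (N + K) * (B / A + A) powr a * (t powr a)\<^sup>2" .
  next
    show "0 < exp (- 6) * A powr a" using A by simp
    have "0 < B / A + A" using A by (simp add: add_pos_pos)
    then show "0 < (N + K) * (B / A + A) powr a"
      using N K by (simp add: add_nonneg_pos)
    show "0 \<le> ?f t" for t
      using order_trans[OF norm_ge_zero cmod_le_sobolev_norm[OF mobius_seq_sobolev(1)[OF cp], of s]] s by simp
  qed simp
qed

theorem mainTheorem11:
  fixes \<beta> :: real
  assumes "\<beta> > 9"
  shows "\<exists>u0 \<in> rational_L1. \<exists>u.
    (\<forall>s > 1/2. unique_beta_szego_solution \<beta> s u0 u) \<and>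
    (\<forall>s > 1/2. comparable_at_top (\<lambda>t. sobolev_norm s (u t)) (\<lambda>t. t powr (2 * s - 1)))"
proof -
  interpret growing_orbit "sqrt \<beta>"
    using assms real_less_rsqrt[of 3 \<beta>] by unfold_locales simp
  let ?u = "\<lambda>t. mobius_seq (b t) (c t) (p t)"
  have "mobius_seq (b 0) (c 0) (p 0) \<in> rational_L1"
    by (rule mobius_seq_in_rational_L1[OF cmod_p_less_1 nonzero(4)])
  moreover have "unique_beta_szego_solution \<beta> s (mobius_seq (b 0) (c 0) (p 0)) ?u" if s: "s > 1 / 2" for s
  proof -
    have "beta_szego_solution \<beta> s (mobius_seq (b 0) (c 0) (p 0)) ?u"
      using solution[of s] s assms by simp
    then show ?thesis
      unfolding unique_beta_szego_solution_def using solution_unique[OF _ _ s] by blast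
  qed
  moreover have "comparable_at_top (\<lambda>t. sobolev_norm s (?u t)) (\<lambda>t. t powr (2 * s - 1))" if s: "s > 1 / 2" for s
    by (rule mobius_seq_polynomial_growth[OF A_pos A_le_B s cmod_c one_minus_cmod_p cmod_b_le])
  ultimately show ?thesis
    by (intro bexI[of _ "mobius_seq (b 0) (c 0) (p 0)"] exI[of _ ?u]) auto
qed

end
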